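(* Let $X$ be a Banach space and let $f_m\colon X\to X$, $m\in\mathbb{N}$, be functions for which there are constants $c>0$ and $q>1$ such that $f_m(0)=0$ and $$\|f_m(u)-f_m(v)\|\le c\,\|u-v\|\,(\|u\|+\|v\|)^q$$ for every $m\in\mathbb{N}$ and every $u,v\in X$. Let $(A_n)_{n\in\mathbb{N}}$ be a sequence of invertible bounded linear operators on $X$ such that the equation $x_{m+1}=A_mx_m$, $m\in\mathbb{N}$, admits a nonuniform $(\mu,\nu)$-dichotomy for some growth rates $\mu=(\mu_n)_{n\in\mathbb{N}_0}$ and $\nu=(\nu_n)_{n\in\mathbb{N}_0}$, with constants $D\ge 1$, $a<0\le b$ and $\varepsilon\ge 0$. Assume that $$\lim_{m\to+\infty}\mu_m^a\,\mu_{m-1}^{-b}\,\nu_{m-1}^{\varepsilon}=0$$ and that the series $\sum_{k=1}^{+\infty}\mu_k^{aq}\nu_k^{\varepsilon}$ is convergent. Define the sequences $\beta=(\beta_m)_{m\in\mathbb{N}}$ and $\tilde\beta=(\tilde\beta_m)_{m\in\mathbb{N}}$ by $$\beta_m=\frac{\mu_{m-1}^a}{\nu_{m-1}^{\varepsilon(1+1/q)}\left(\sum_{k=m}^{+\infty}\mu_k^{aq}\nu_k^{\varepsilon}\right)^{1/q}},\qquad \tilde\beta_m=\beta_m\,\nu_{m-1}^{-\varepsilon},$$ and suppose that there is a constant $K\ge 1$ such that $$\frac{\mu_m^a\beta_m^{-1}}{\mu_{n-1}^a\beta_n^{-1}}\le K\quad\text{for every } n\in\mathbb{N}\text{ and every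 } m\ge n.$$ Then, for every $C>D$, choosing $\delta>0$ sufficiently small, there is a unique $\phi\in\mathcal{X}_{\delta,\beta}$ such that $$\mathcal{F}_{m,n}\bigl(\mathcal{V}_{\phi,n,\delta/(CK),\tilde\beta}\bigr)\subseteq\mathcal{V}_{\phi,m,\delta,\beta}\quad\text{for every } n\in\mathbb{N}\text{ and every } m\ge n.$$ Furthermore, given $n\in\mathbb{N}$, we have $$\|\mathcal{F}_{m,n}(\xi,\phi_n(\xi))-\mathcal{F}_{m,n}(\bar\xi,\phi_n(\bar\xi))\|\le 2C\left(\frac{\mu_m}{\mu_{n-1}}\right)^a\nu_{n-1}^{\varepsilon}\,\|\xi-\bar\xi\|$$ for every $m\ge n$ and every $\xi,\bar\xi\in B_n(\delta\tilde\beta_n/(CK))$.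
   Context: $\mathbb{N}=\{1,2,\dots\}$, $\mathbb{N}_0=\mathbb{N}\cup\{0\}$. A growth rate is an increasing sequence $\mu=(\mu_n)_{n\in\mathbb{N}_0}$ of real numbers with $\mu_0\ge 1$ and $\lim_{n\to+\infty}\mu_n=+\infty$. Given a sequence $(A_n)_{n\in\mathbb{N}}$ of invertible bounded linear operators on $X$, put $\mathcal{A}_{m,n}=A_{m-1}\cdots A_n$ if $m>n$ and $\mathcal{A}_{n,n}=\mathrm{Id}$. The equation $x_{m+1}=A_mx_m$, $m\in\mathbb{N}$, admits a nonuniform $(\mu,\nu)$-dichotomy (for growth rates $\mu,\nu$) if there exist projections $P_m$, $m\in\mathbb{N}$, with $P_m\mathcal{A}_{m,n}=\mathcal{A}_{m,n}P_n$ for $m\ge n$ in $\mathbb{N}$, and constants $a<0\le b$, $\varepsilon\ge0$, $D\ge1$ such that for every $n\in\mathbb{N}$ and every $m\ge n$ $$\|\mathcal{A}_{m,n}P_n\|\le D\left(\frac{\mu_m}{\mu_{n-1}}\right)^a\nu_{n-1}^{\varepsilon},\qquad \|\mathcal{A}_{m,n}^{-1}Q_m\|\le D\left(\frac{\mu_{m-1}}{\mu_n}\right)^{-b}\nu_{m-1}^{\varepsilon},$$ where $Q_m=\mathrm{Id}-P_m$. The projections are fixed, and $E_n=P_n(X)$, $F_n=Q_n(X)$. The spaces $E_n\times F_n$ and $E_n\oplus F_n=X$ are identified, so $(\xi,\eta)\in E_n\times F_n$ is the vector $\xi+\eta\in X$. For $m>n$, $\mathcal{F}_{m,n}=(A_{m-1}+f_{m-1})\circ\cdots\circ(A_n+f_n)$,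 and $\mathcal{F}_{n,n}=\mathrm{Id}$. $B_n(r)$ is the open ball of $E_n$ centered at $0$ with radius $r>0$. For $\delta>0$ and a positive sequence $\beta=(\beta_n)_{n\in\mathbb{N}}$, $\mathcal{X}_{\delta,\beta}$ is the space of sequences $\phi=(\phi_n)_{n\in\mathbb{N}}$ of continuous functions $\phi_n\colon B_n(\delta\beta_n)\to F_n$ such that $\phi_n(0)=0$ and $\|\phi_n(\xi)-\phi_n(\bar\xi)\|\le\|\xi-\bar\xi\|$ for every $n\in\mathbb{N}$ and every $\xi,\bar\xi\in B_n(\delta\beta_n)$. For a sequence $\phi=(\phi_n)_{n\in\mathbb{N}}\in\mathcal{X}_{\delta,\beta}$ (with $\delta>0$ and $\beta=(\beta_n)_{n\in\mathbb{N}}$ a positive sequence), $\delta'>0$ and a positive sequence $\beta'=(\beta'_n)_{n\in\mathbb{N}}$ such that $\phi_n$ is defined on $B_n(\delta'\beta'_n)$, put $\mathcal{V}_{\phi,n,\delta',\beta'}=\{(\xi,\phi_n(\xi)):\xi\in B_n(\delta'\beta'_n)\}$.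
   Formalization: Uniqueness of φ is asserted only on the smaller balls B_n(δβ̃_n/(CK)), not on all of B_n(δβ_n): invariance does not determine φ_n elsewhere off the orbits, so literal uniqueness fails (e.g. X=R², A_n=diag(1/2,1), f=0). *)

theory Defs
  imports "HOL-Analysis.Analysis"
begin

text \<open>
  Sequences indexed by the positive integers are functions on \<^typ>\<open>nat\<close> whose value at \<open>0\<close> is never
  used; growth rates are indexed by all of \<^typ>\<open>nat\<close>.
\<close>

definition growth_rate :: "(nat \<Rightarrow> real) \<Rightarrow> bool" where
  "growth_rate \<mu> \<longleftrightarrow> incseq \<mu> \<and> 1 \<le> \<mu> 0 \<and> filterlim \<mu> at_top sequentially"

definition blinfun_invertible :: "('a::real_normed_vector \<Rightarrow>\<^sub>L 'a) \<Rightarrow> bool" where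
  "blinfun_invertible T \<longleftrightarrow> (\<exists>S. S o\<^sub>L T = id_blinfun \<and> T o\<^sub>L S = id_blinfun)"

definition blinfun_inverse :: "('a::real_normed_vector \<Rightarrow>\<^sub>L 'a) \<Rightarrow> ('a \<Rightarrow>\<^sub>L 'a)" where
  "blinfun_inverse T = (THE S. S o\<^sub>L T = id_blinfun \<and> T o\<^sub>L S = id_blinfun)"

text \<open>\<open>evol A m n = A (m - 1) o\<^sub>L \<dots> o\<^sub>L A n\<close> for \<open>m \<ge> n\<close>; only this case is meaningful.\<close>

primrec evol :: "(nat \<Rightarrow> 'a::real_normed_vector \<Rightarrow>\<^sub>L 'a) \<Rightarrow> nat \<Rightarrow> nat \<Rightarrow> 'a \<Rightarrow>\<^sub>L 'a" where
  "evol A 0 n = id_blinfun"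
| "evol A (Suc m) n = (if n \<le> m then A m o\<^sub>L evol A m n else id_blinfun)"

primrec nonlinear_evol ::
  "(nat \<Rightarrow> 'a::real_normed_vector \<Rightarrow>\<^sub>L 'a) \<Rightarrow> (nat \<Rightarrow> 'a \<Rightarrow> 'a) \<Rightarrow> nat \<Rightarrow> nat \<Rightarrow> 'a \<Rightarrow> 'a" where
  "nonlinear_evol A f 0 n = id"
| "nonlinear_evol A f (Suc m) n =
     (if n \<le> m then (\<lambda>x. A m x + f m x) \<circ> nonlinear_evol A f m n else id)"

definition compl_proj :: "('a::real_normed_vector \<Rightarrow>\<^sub>L 'a) \<Rightarrow> ('a \<Rightarrow>\<^sub>L 'a)" where
  "compl_proj P = id_blinfun - P"

definition nonuniform_dichotomy ::
  "(nat \<Rightarrow> 'a::real_normed_vector \<Rightarrow>\<^sub>L 'a) \<Rightarrow> (nat \<Rightarrow> real) \<Rightarrow> (nat \<Rightarrow> real) \<Rightarrow> (nat \<Rightarrow> 'a \<Rightarrow>\<^sub>L 'a) \<Rightarrow>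
    real \<Rightarrow> real \<Rightarrow> real \<Rightarrow> real \<Rightarrow> bool" where
  "nonuniform_dichotomy A \<mu> \<nu> P a b \<epsilon> D \<longleftrightarrow>
     a < 0 \<and> 0 \<le> b \<and> 0 \<le> \<epsilon> \<and> 1 \<le> D \<and>
     (\<forall>m\<ge>1. P m o\<^sub>L P m = P m) \<and>
     (\<forall>n\<ge>1. \<forall>m\<ge>n. P m o\<^sub>L evol A m n = evol A m n o\<^sub>L P n) \<and>
     (\<forall>n\<ge>1. \<forall>m\<ge>n.
        norm (evol A m n o\<^sub>L P n) \<le> D * (\<mu> m / \<mu> (n - 1)) powr a * \<nu> (n - 1) powr \<epsilon> \<and>
        norm (blinfun_inverse (evol A m n) o\<^sub>L compl_proj (P m))
          \<le> D * (\<mu> (m - 1) / \<mu> n) powr (- b) * \<nu> (m - 1) powr \<epsilon>)"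

definition stable_space :: "(nat \<Rightarrow> 'a::real_normed_vector \<Rightarrow>\<^sub>L 'a) \<Rightarrow> nat \<Rightarrow> 'a set" where
  "stable_space P n = range (blinfun_apply (P n))"

definition unstable_space :: "(nat \<Rightarrow> 'a::real_normed_vector \<Rightarrow>\<^sub>L 'a) \<Rightarrow> nat \<Rightarrow> 'a set" where
  "unstable_space P n = range (blinfun_apply (compl_proj (P n)))"

definition stable_ball :: "(nat \<Rightarrow> 'a::real_normed_vector \<Rightarrow>\<^sub>L 'a) \<Rightarrow> nat \<Rightarrow> real \<Rightarrow> 'a set" where
  "stable_ball P n r = {\<xi> \<in> stable_space P n. norm \<xi> < r}"

text \<open>
  Only the values of \<open>\<phi> n\<close> on \<open>stable_ball P n (\<delta> * \<beta> n)\<close> are constrained, so a partial function is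
  represented by any of its total extensions, and equality of partial functions has to be stated
  pointwise on the relevant ball.
\<close>

definition graph_space ::
  "(nat \<Rightarrow> 'a::real_normed_vector \<Rightarrow>\<^sub>L 'a) \<Rightarrow> real \<Rightarrow> (nat \<Rightarrow> real) \<Rightarrow> (nat \<Rightarrow> 'a \<Rightarrow> 'a) set" where
  "graph_space P \<delta> \<beta> = {\<phi>. \<forall>n\<ge>1.
     \<phi> n \<in> stable_ball P n (\<delta> * \<beta> n) \<rightarrow> unstable_space P n \<and>
     continuous_on (stable_ball P n (\<delta> * \<beta> n)) (\<phi> n) \<and>
     \<phi> n 0 = 0 \<and>
     (\<forall>\<xi>\<in>stable_ball P n (\<delta> * \<beta> n). \<forall>\<xi>'\<in>stable_ball P n (\<delta> * \<beta> n).
        norm (\<phi> n \<xi> - \<phi> n \<xi>') \<le> norm (\<xi> - \<xi>'))}"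

definition local_graph ::
  "(nat \<Rightarrow> 'a::real_normed_vector \<Rightarrow>\<^sub>L 'a) \<Rightarrow> (nat \<Rightarrow> 'a \<Rightarrow> 'a) \<Rightarrow> nat \<Rightarrow> real \<Rightarrow> (nat \<Rightarrow> real) \<Rightarrow> 'a set"
  where "local_graph P \<phi> n \<delta> \<beta> = (\<lambda>\<xi>. \<xi> + \<phi> n \<xi>) ` stable_ball P n (\<delta> * \<beta> n)"

text \<open>
  Invariance constrains \<open>\<phi> n\<close> only on the smaller ball \<open>stable_ball P n (\<delta>' * \<beta>' n)\<close> and at the orbit
  points issued from such balls. The remaining values on \<open>stable_ball P n (\<delta> * \<beta> n)\<close> are not
  determined, so uniqueness can only be expected on the smaller balls.
\<close>

definition locally_invariant ::
  "(nat \<Rightarrow> 'a::real_normed_vector \<Rightarrow>\<^sub>L 'a) \<Rightarrow> (nat \<Rightarrow> 'a \<Rightarrow> 'a) \<Rightarrow> (nat \<Rightarrow> 'a \<Rightarrow>\<^sub>L 'a) \<Rightarrow>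
    real \<Rightarrow> (nat \<Rightarrow> real) \<Rightarrow> real \<Rightarrow> (nat \<Rightarrow> real) \<Rightarrow> (nat \<Rightarrow> 'a \<Rightarrow> 'a) \<Rightarrow> bool" where
  "locally_invariant A f P \<delta>' \<beta>' \<delta> \<beta> \<phi> \<longleftrightarrow>
     (\<forall>n\<ge>1. \<forall>m\<ge>n.
        nonlinear_evol A f m n ` local_graph P \<phi> n \<delta>' \<beta>' \<subseteq> local_graph P \<phi> m \<delta> \<beta>)"

definition tail_sum :: "(nat \<Rightarrow> real) \<Rightarrow> (nat \<Rightarrow> real) \<Rightarrow> real \<Rightarrow> real \<Rightarrow> real \<Rightarrow> nat \<Rightarrow> real" where
  "tail_sum \<mu> \<nu> a \<epsilon> q m = (\<Sum>k. \<mu> (k + m) powr (a * q) * \<nu> (k + m) powr \<epsilon>)"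

definition radius :: "(nat \<Rightarrow> real) \<Rightarrow> (nat \<Rightarrow> real) \<Rightarrow> real \<Rightarrow> real \<Rightarrow> real \<Rightarrow> nat \<Rightarrow> real" where
  "radius \<mu> \<nu> a \<epsilon> q m =
     \<mu> (m - 1) powr a /
       (\<nu> (m - 1) powr (\<epsilon> * (1 + 1 / q)) * tail_sum \<mu> \<nu> a \<epsilon> q m powr (1 / q))"

definition inner_radius :: "(nat \<Rightarrow> real) \<Rightarrow> (nat \<Rightarrow> real) \<Rightarrow> real \<Rightarrow> real \<Rightarrow> real \<Rightarrow> nat \<Rightarrow> real" where
  "inner_radius \<mu> \<nu> a \<epsilon> q m = radius \<mu> \<nu> a \<epsilon> q m * \<nu> (m - 1) powr (- \<epsilon>)"

end

theory Submission
  imports Defs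
begin

text \<open>
  The proof follows Lyapunov and Perron: near \<open>0\<close>, the graph of \<open>\<phi> n\<close> is the set of initial values
  at time \<open>n\<close> whose orbits under \<open>x \<mapsto> A k x + f k x\<close> are bounded by a suitable small multiple of
  \<open>\<mu> k powr a\<close>. Write \<open>p k = \<mu> k powr a\<close> and \<open>e k = \<nu> k powr \<epsilon>\<close>.

  Suppose that \<open>x (k + 1) = A k (x k) + g k\<close> and \<open>norm (x k) \<le> M * p k\<close> from time \<open>n\<close> on. The stable
  part of \<open>x\<close> is computed forwards from time \<open>n\<close>. The unstable part is computed backwards from a
  time \<open>N\<close>; by the limit hypothesis the contribution of \<open>x N\<close> vanishes as \<open>N\<close> tends to infinity, so
  the unstable part is determined by \<open>g\<close> alone. If \<open>norm (g l) \<le> H * p l * p l powr q\<close>, both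
  contributions of \<open>g\<close> are at most \<open>D * H * S n * p k\<close>, where \<open>S n\<close> is the tail from \<open>n\<close> of the series
  of the \<open>e l * p l powr q\<close>: this is \<open>forced_orbit_bound\<close>, with the converse existence statement
  \<open>forced_orbit_exists\<close>.

  For two orbits of the nonlinear equation that are bounded by \<open>M * p k\<close>, the difference solves such
  an equation, with \<open>H\<close> equal to \<open>c * (2 * M) powr q\<close> times the weighted size of the difference. As
  soon as \<open>\<kappa> n M = c * D * (2 * M) powr q * S n\<close> is small, the forcing term is therefore absorbed, and
  the difference is controlled by its stable part at time \<open>n\<close> (\<open>decaying_diff\<close>). The same
  contraction gives, by the Banach fixed point theorem, a decaying orbit with any prescribed small
  stable part (\<open>decaying_exists\<close>). The radii \<open>\<beta> n\<close> are exactly such that the orbits issued from a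
  ball of radius \<open>\<delta> * \<beta> n\<close> have \<open>\<kappa> n M\<close> proportional to \<open>\<delta> powr q / e (n - 1)\<close>; the factor
  \<open>1 / e (n - 1)\<close> compensates the nonuniformity and makes \<open>\<phi> n\<close> Lipschitz with constant \<open>1\<close>.

  Invariance holds because a decaying orbit stays decaying when it is restarted later, and because
  the hypothesis involving \<open>K\<close> keeps its stable part in the larger balls. For uniqueness, on the graph
  of a competitor \<open>\<psi>\<close> the unstable part is dominated by the stable part, so the forward estimate alone
  shows that orbits starting on that graph decay, and hence that they lie on the graph of \<open>\<phi>\<close>.
\<close>

section \<open>Evolution operators and their inverses\<close>

lemma evol_same [simp]: "evol A n n = id_blinfun"
  by (cases n) auto

lemma nonlinear_evol_same [simp]: "nonlinear_evol A f n n = id"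
  by (cases n) auto

lemma blinfun_compose_assoc: "(R o\<^sub>L S) o\<^sub>L T = R o\<^sub>L (S o\<^sub>L T)"
  by (rule blinfun_eqI) simp

lemma id_blinfun_compose [simp]: "id_blinfun o\<^sub>L T = T" "T o\<^sub>L id_blinfun = T"
  by (simp_all add: blinfun_eqI)

lemma evol_trans:
  assumes "n \<le> k" "k \<le> m"
  shows "evol A m n = evol A m k o\<^sub>L evol A k n"
  using assms(2)
proof (induction m rule: dec_induct)
  case base
  show ?case by simp
next
  case (step m)
  then show ?case
    using assms(1) by (simp add: blinfun_compose_assoc)
qed

lemma nonlinear_evol_trans:
  assumes "n \<le> k" "k \<le> m"
  shows "nonlinear_evol A f m n v = nonlinear_evol A f m k (nonlinear_evol A f k n v)"
  using assms(2)
proof (induction m rule: dec_induct)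
  case base
  show ?case by simp
next
  case (step m)
  then show ?case
    using assms(1) by simp
qed

lemma blinfun_inverse_unique:
  assumes "S o\<^sub>L T = id_blinfun" "T o\<^sub>L S = id_blinfun"
  shows "blinfun_inverse T = S"
  unfolding blinfun_inverse_def
proof (rule the_equality)
  fix R assume R: "R o\<^sub>L T = id_blinfun \<and> T o\<^sub>L R = id_blinfun"
  have "R = R o\<^sub>L (T o\<^sub>L S)" using assms by simp
  also have "\<dots> = S" using R by (simp flip: blinfun_compose_assoc)
  finally show "R = S" .
qed (use assms in simp)

lemma blinfun_inverse_cancel:
  assumes "blinfun_invertible T"
  shows "blinfun_inverse T o\<^sub>L T = id_blinfun" "T o\<^sub>L blinfun_inverse T = id_blinfun"
  using assms blinfun_inverse_unique unfolding blinfun_invertible_def by metis+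

lemma blinfun_invertible_compose:
  assumes "blinfun_invertible S" "blinfun_invertible T"
  shows "blinfun_invertible (S o\<^sub>L T)"
proof -
  obtain S' where S: "S' o\<^sub>L S = id_blinfun" "S o\<^sub>L S' = id_blinfun"
    using assms(1) unfolding blinfun_invertible_def by auto
  obtain T' where T: "T' o\<^sub>L T = id_blinfun" "T o\<^sub>L T' = id_blinfun"
    using assms(2) unfolding blinfun_invertible_def by auto
  have "(T' o\<^sub>L S') o\<^sub>L (S o\<^sub>L T) = T' o\<^sub>L (S' o\<^sub>L S) o\<^sub>L T"
    by (simp only: blinfun_compose_assoc)
  moreover have "(S o\<^sub>L T) o\<^sub>L (T' o\<^sub>L S') = S o\<^sub>L (T o\<^sub>L T') o\<^sub>L S'"
    by (simp only: blinfun_compose_assoc)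
  ultimately show ?thesis
    using S T unfolding blinfun_invertible_def by auto
qed

lemma blinfun_compose_eqD:
  assumes "S o\<^sub>L T = R"
  shows "blinfun_apply S (blinfun_apply T x) = blinfun_apply R x"
  using assms by auto

lemma norm_blinfun_le:
  assumes "norm T \<le> K" "norm x \<le> R" "0 \<le> K"
  shows "norm (blinfun_apply T x) \<le> K * R"
  by (rule order_trans[OF norm_blinfun mult_mono]) (use assms in auto)

section \<open>Weighted dichotomies\<close>

text \<open>
  What the dichotomy, the limit hypothesis and the summability hypothesis provide, expressed through
  the weights \<open>p k = \<mu> k powr a\<close> and \<open>e k = \<nu> k powr \<epsilon>\<close>. For \<open>unstable_bound\<close>
  the factor \<open>(\<mu> m / \<mu> n) powr (- b)\<close>, \<open>m \<ge> n\<close>, is estimated by \<open>1\<close>; for \<open>unstable_decay\<close> it is kept and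
  combined with \<open>p m\<close>, so that the limit hypothesis applies.
\<close>

locale weighted_dichotomy =
  fixes A :: "nat \<Rightarrow> 'a::banach \<Rightarrow>\<^sub>L 'a"
    and P :: "nat \<Rightarrow> 'a \<Rightarrow>\<^sub>L 'a"
    and p e :: "nat \<Rightarrow> real"
    and D q :: real
  assumes inv: "\<And>m. m \<ge> 1 \<Longrightarrow> blinfun_invertible (A m)"
    and P_idem: "\<And>m. m \<ge> 1 \<Longrightarrow> P m o\<^sub>L P m = P m"
    and P_commute: "\<And>m. m \<ge> 1 \<Longrightarrow> P (Suc m) o\<^sub>L A m = A m o\<^sub>L P m"
    and p_pos: "\<And>k. p k > 0"
    and p_antimono: "\<And>k l. k \<le> l \<Longrightarrow> p l \<le> p k"
    and e_ge: "\<And>k. e k \<ge> 1"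
    and D_ge: "D \<ge> 1"
    and stable_bound: "\<And>m n. 1 \<le> n \<Longrightarrow> n \<le> m \<Longrightarrow>
          norm (evol A m n o\<^sub>L P n) \<le> D * (p m / p (n - 1)) * e (n - 1)"
    and unstable_bound: "\<And>m n. 1 \<le> n \<Longrightarrow> n \<le> m \<Longrightarrow>
          norm (blinfun_inverse (evol A (Suc m) n) o\<^sub>L compl_proj (P (Suc m))) \<le> D * e m"
    and unstable_decay: "\<And>n. 1 \<le> n \<Longrightarrow>
          (\<lambda>m. norm (blinfun_inverse (evol A m n) o\<^sub>L compl_proj (P m)) * p m) \<longlonglongrightarrow> 0"
    and summable_weight: "summable (\<lambda>l. e l * p l powr q)"
begin

abbreviation Q :: "nat \<Rightarrow> 'a \<Rightarrow>\<^sub>L 'a" where "Q m \<equiv> compl_proj (P m)"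

abbreviation W :: "nat \<Rightarrow> nat \<Rightarrow> 'a \<Rightarrow>\<^sub>L 'a" where "W m n \<equiv> blinfun_inverse (evol A m n)"

definition S :: "nat \<Rightarrow> real" where "S n = (\<Sum>j. e (j + n) * p (j + n) powr q)"

text \<open>
  A solution of the inhomogeneous linear equation. The estimates below are proved for an arbitrary
  forcing \<open>g\<close>, so that they apply to single orbits, to differences of orbits and to the iterates of
  the fixed point argument.
\<close>

definition forced_orbit :: "(nat \<Rightarrow> 'a) \<Rightarrow> nat \<Rightarrow> (nat \<Rightarrow> 'a) \<Rightarrow> bool" where
  "forced_orbit g n x \<longleftrightarrow> (\<forall>k\<ge>n. x (Suc k) = A k (x k) + g k)"

lemma e_pos: "e k > 0"
  using e_ge[of k] by linarith

lemma summable_tail: "summable (\<lambda>j. e (j + n) * p (j + n) powr q)"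
  by (rule summable_ignore_initial_segment[OF summable_weight])

lemma weight_pos: "0 < e l * p l powr q"
  using e_pos[of l] p_pos[of l] by simp

lemmas weight_nonneg = weight_pos[THEN less_imp_le]

lemma S_pos: "S n > 0"
  unfolding S_def by (rule suminf_pos[OF summable_tail weight_pos])

lemma sum_le_S: "(\<Sum>l\<in>{n..<k}. e l * p l powr q) \<le> S n"
proof (cases "n \<le> k")
  case True
  then have "(\<Sum>l\<in>{n..<k}. e l * p l powr q) = (\<Sum>j<k - n. e (j + n) * p (j + n) powr q)"
    by (intro sum.reindex_bij_witness[of _ "\<lambda>j. j + n" "\<lambda>l. l - n"]) auto
  also have "\<dots> \<le> S n"
    unfolding S_def by (rule sum_le_suminf[OF summable_tail]) (use weight_nonneg in auto)
  finally show ?thesis .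
qed (use S_pos[of n] in simp)

lemma S_antimono:
  assumes "n \<le> m"
  shows "S m \<le> S n"
  unfolding S_def[of m]
proof (rule suminf_le_const[OF summable_tail])
  fix k
  have "(\<Sum>j<k. e (j + m) * p (j + m) powr q) = (\<Sum>l\<in>{m..<m + k}. e l * p l powr q)"
    by (intro sum.reindex_bij_witness[of _ "\<lambda>l. l - m" "\<lambda>j. j + m"]) auto
  also have "\<dots> \<le> (\<Sum>l\<in>{n..<m + k}. e l * p l powr q)"
    by (rule sum_mono2) (use assms weight_nonneg in auto)
  also have "\<dots> \<le> S n" by (rule sum_le_S)
  finally show "(\<Sum>j<k. e (j + m) * p (j + m) powr q) \<le> S n" .
qed

lemma P_P: "m \<ge> 1 \<Longrightarrow> P m (P m x) = P m x"
  by (rule blinfun_compose_eqD[OF P_idem])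

lemma Q_apply: "Q m x = x - P m x"
  by (simp add: compl_proj_def blinfun.diff_left)

lemma P_Q: "m \<ge> 1 \<Longrightarrow> P m (Q m x) = 0"
  by (simp add: Q_apply blinfun.diff_right P_P)

lemma P_add_Q: "P m x + Q m x = x"
  by (simp add: Q_apply)

lemma P_A: "m \<ge> 1 \<Longrightarrow> P (Suc m) (A m x) = A m (P m x)"
  using blinfun_compose_eqD[OF P_commute] by simp

lemma Q_A: "m \<ge> 1 \<Longrightarrow> Q (Suc m) (A m x) = A m (Q m x)"
  by (simp add: Q_apply P_A blinfun.diff_right)

lemma evol_invertible:
  assumes "1 \<le> n" "n \<le> m"
  shows "blinfun_invertible (evol A m n)"
  using assms(2)
proof (induction m rule: dec_induct)
  case base
  show ?case by (simp add: blinfun_invertible_def)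
next
  case (step m)
  then show ?case
    using assms(1) inv by (auto intro: blinfun_invertible_compose)
qed

lemma W_same: "W m m = id_blinfun"
  by (simp add: blinfun_inverse_unique[of id_blinfun id_blinfun])

lemma W_trans:
  assumes "1 \<le> n" "n \<le> k" "k \<le> m"
  shows "W m n = W k n o\<^sub>L W m k"
proof -
  note c = blinfun_inverse_cancel[OF evol_invertible]
  have *: "evol A m n = evol A m k o\<^sub>L evol A k n" using assms evol_trans by blast
  have "(W k n o\<^sub>L W m k) o\<^sub>L (evol A m k o\<^sub>L evol A k n) = W k n o\<^sub>L (W m k o\<^sub>L evol A m k) o\<^sub>L evol A k n"
    by (simp only: blinfun_compose_assoc)
  moreover have "(evol A m k o\<^sub>L evol A k n) o\<^sub>L (W k n o\<^sub>L W m k)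
      = evol A m k o\<^sub>L (evol A k n o\<^sub>L W k n) o\<^sub>L W m k"
    by (simp only: blinfun_compose_assoc)
  ultimately show ?thesis
    unfolding * using c[of n k] c[of k m] assms by (intro blinfun_inverse_unique) auto
qed

lemma W_Suc_A:
  assumes "1 \<le> n" "n \<le> m"
  shows "W (Suc m) n (A m y) = W m n y"
proof -
  have "W (Suc m) m o\<^sub>L A m = id_blinfun"
    using blinfun_inverse_cancel(1)[OF evol_invertible[of m "Suc m"]] assms by simp
  then have "W (Suc m) m (A m y) = y"
    by (simp add: blinfun_compose_eqD)
  then show ?thesis
    using W_trans[of n m "Suc m"] assms by simp
qed

lemma A_W:
  assumes "1 \<le> n" "Suc n \<le> m"
  shows "A n (W m n y) = W m (Suc n) y"
proof -
  have "A n o\<^sub>L W (Suc n) n = id_blinfun"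
    using blinfun_inverse_cancel(2)[OF evol_invertible[of n "Suc n"]] assms by simp
  then have "A n (W (Suc n) n x) = x" for x
    by (simp add: blinfun_compose_eqD)
  then show ?thesis
    using W_trans[of n "Suc n" m] assms by simp
qed

lemma P_evol:
  assumes "1 \<le> n" "n \<le> m"
  shows "P m (evol A m n y) = evol A m n (P n y)"
  using assms(2)
proof (induction m rule: dec_induct)
  case (step m)
  then show ?case using P_A \<open>1 \<le> n\<close> by simp
qed simp

lemma P_W:
  assumes "1 \<le> n" "n \<le> m"
  shows "P n (W m n y) = W m n (P m y)"
proof -
  have c: "evol A m n (W m n z) = z" "W m n (evol A m n z) = z" for z
    using blinfun_inverse_cancel[OF evol_invertible[OF assms]] by (simp_all add: blinfun_compose_eqD)
  have "evol A m n (P n (W m n y)) = P m y"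
    using P_evol[OF assms, of "W m n y"] c(1) by simp
  then show ?thesis using c(2) by metis
qed

section \<open>The inhomogeneous linear equation\<close>

lemma variation_of_constants:
  assumes "n \<le> k" and "\<And>l. n \<le> l \<Longrightarrow> l < k \<Longrightarrow> x (Suc l) = A l (x l) + g l"
  shows "x k = evol A k n (x n) + (\<Sum>l\<in>{n..<k}. evol A k (Suc l) (g l))"
  using assms
proof (induction k rule: dec_induct)
  case base
  show ?case by simp
next
  case (step k)
  have "x (Suc k) = A k (x k) + g k" using step by simp
  also have "x k = evol A k n (x n) + (\<Sum>l\<in>{n..<k}. evol A k (Suc l) (g l))"
    using step by simp
  also have "A k \<dots> = evol A (Suc k) n (x n) + (\<Sum>l\<in>{n..<k}. A k (evol A k (Suc l) (g l)))"
    using step by (simp add: blinfun.add_right blinfun.sum_right)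
  also have "(\<Sum>l\<in>{n..<k}. A k (evol A k (Suc l) (g l))) = (\<Sum>l\<in>{n..<k}. evol A (Suc k) (Suc l) (g l))"
    by (intro sum.cong) auto
  finally show ?case using step by simp
qed

text \<open>
  In the variation of constants formula for the stable part, the term of index \<open>l\<close> carries the factor
  \<open>p k / p l * e l\<close>. The forcing bound contributes \<open>p l * p l powr q\<close>, so \<open>p l\<close> cancels and a partial
  sum of \<open>S n\<close> remains. Only the times before \<open>k\<close> occur, which permits the use of this estimate
  inside an induction along an orbit.
\<close>

lemma stable_estimate:
  assumes "1 \<le> n" "n \<le> k"
    and x: "\<And>l. n \<le> l \<Longrightarrow> l < k \<Longrightarrow> x (Suc l) = A l (x l) + g l"
    and g: "\<And>l. n \<le> l \<Longrightarrow> l < k \<Longrightarrow> norm (g l) \<le> H * (p l * p l powr q)"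
    and "0 \<le> H"
  shows "norm (P k (x k)) \<le> (D * (e (n - 1) / p (n - 1)) * norm (P n (x n)) + D * H * S n) * p k"
proof -
  have "P k (x k) = evol A k n (P n (x n)) + (\<Sum>l\<in>{n..<k}. evol A k (Suc l) (P (Suc l) (g l)))"
    by (rule variation_of_constants[OF \<open>n \<le> k\<close>, of "\<lambda>k. P k (x k)"])
      (use x P_A \<open>1 \<le> n\<close> in \<open>simp add: blinfun.add_right\<close>)
  moreover have "norm (evol A k n (P n (x n))) \<le> D * (p k / p (n - 1)) * e (n - 1) * norm (P n (x n))"
  proof -
    have "evol A k n (P n (x n)) = (evol A k n o\<^sub>L P n) (P n (x n))"
      using P_P assms(1) by simp
    then show ?thesis
      using norm_blinfun_le[OF stable_bound order_refl, of n k "P n (x n)"] assms(1,2)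
        D_ge p_pos[of k] p_pos[of "n-1"] e_pos[of "n-1"] by simp
  qed
  moreover have "norm (evol A k (Suc l) (P (Suc l) (g l))) \<le> D * H * p k * (e l * p l powr q)"
    if "l \<in> {n..<k}" for l
  proof -
    have "norm ((evol A k (Suc l) o\<^sub>L P (Suc l)) (g l)) \<le> (D * (p k / p l) * e l) * (H * (p l * p l powr q))"
      using norm_blinfun_le[OF stable_bound g, of "Suc l" k l] that assms(1,2)
        D_ge p_pos[of k] p_pos[of l] e_pos[of l] by simp
    also have "\<dots> = D * H * p k * (e l * p l powr q)"
      using p_pos[of l] by (simp add: field_simps)
    finally show ?thesis by simp
  qed
  then have "norm (\<Sum>l\<in>{n..<k}. evol A k (Suc l) (P (Suc l) (g l)))
      \<le> (\<Sum>l\<in>{n..<k}. D * H * p k * (e l * p l powr q))"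
    by (intro sum_norm_le) auto
  moreover have "(\<Sum>l\<in>{n..<k}. D * H * p k * (e l * p l powr q)) \<le> D * H * p k * S n"
    unfolding sum_distrib_left[symmetric]
    by (intro mult_left_mono sum_le_S) (use D_ge \<open>0 \<le> H\<close> p_pos[of k] in auto)
  ultimately have "norm (P k (x k)) \<le>
      D * (p k / p (n - 1)) * e (n - 1) * norm (P n (x n)) + D * H * p k * S n"
    using norm_triangle_le by (smt (verit))
  then show ?thesis by (simp add: algebra_simps)
qed

lemma unstable_forcing_bound:
  assumes "1 \<le> n" "n \<le> l" "norm (g l) \<le> H * (p l * p l powr q)" "0 \<le> H"
  shows "norm (W (Suc l) n (Q (Suc l) (g l))) \<le> D * H * p n * (e l * p l powr q)"
proof -
  have "norm ((W (Suc l) n o\<^sub>L Q (Suc l)) (g l)) \<le> (D * e l) * (H * (p l * p l powr q))"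
    using norm_blinfun_le[OF unstable_bound assms(3)] assms D_ge e_pos[of l] by simp
  also have "\<dots> = D * H * (e l * p l powr q) * p l"
    by simp
  also have "\<dots> \<le> D * H * (e l * p l powr q) * p n"
    by (intro mult_left_mono p_antimono) (use assms D_ge weight_nonneg in auto)
  finally show ?thesis by (simp add: mult_ac)
qed

lemma unstable_variation_of_constants:
  assumes "1 \<le> n" "n \<le> N" and x: "forced_orbit g n x"
  shows "Q n (x n) = W N n (Q N (x N)) - (\<Sum>l\<in>{n..<N}. W (Suc l) n (Q (Suc l) (g l)))"
  using assms(2)
proof (induction N rule: dec_induct)
  case base
  show ?case using W_same[of n] by simp
next
  case (step N)
  have "W (Suc N) n (Q (Suc N) (x (Suc N))) = W N n (Q N (x N)) + W (Suc N) n (Q (Suc N) (g N))"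
    using x step assms(1) Q_A W_Suc_A unfolding forced_orbit_def by (simp add: blinfun.add_right)
  then show ?case using step by simp
qed

text \<open>
  For an orbit of order \<open>p N\<close> the boundary term at time \<open>N\<close> tends to zero by \<open>unstable_decay\<close>. In the
  limit the unstable part is minus the series of the pulled back forcing terms.
\<close>

lemma unstable_estimate:
  assumes "1 \<le> n" and x: "forced_orbit g n x"
    and bdd: "\<And>k. n \<le> k \<Longrightarrow> norm (x k) \<le> M * p k"
    and g: "\<And>l. n \<le> l \<Longrightarrow> norm (g l) \<le> H * (p l * p l powr q)"
    and "0 \<le> H"
  shows "norm (Q n (x n)) \<le> D * H * S n * p n"
proof -
  define r where "r N = norm (W N n o\<^sub>L Q N) * p N" for N
  have "norm (Q n (x n)) \<le> M * r N + D * H * S n * p n" if "N \<ge> n" for N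
  proof -
    have "norm (W N n (Q N (x N))) \<le> norm (W N n o\<^sub>L Q N) * (M * p N)"
      using norm_blinfun_le[OF order_refl bdd[OF that], of "W N n o\<^sub>L Q N"] by simp
    then have "norm (W N n (Q N (x N))) \<le> M * r N" by (simp add: r_def mult_ac)
    moreover have "norm (\<Sum>l\<in>{n..<N}. W (Suc l) n (Q (Suc l) (g l)))
        \<le> (\<Sum>l\<in>{n..<N}. D * H * p n * (e l * p l powr q))"
      by (intro sum_norm_le unstable_forcing_bound) (use assms in auto)
    moreover have "\<dots> \<le> D * H * p n * S n"
      unfolding sum_distrib_left[symmetric]
      by (intro mult_left_mono sum_le_S) (use D_ge \<open>0 \<le> H\<close> p_pos[of n] in auto)
    ultimately show ?thesis
      unfolding unstable_variation_of_constants[OF assms(1) that x]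
      by (smt (verit) norm_triangle_ineq4 mult.commute mult.left_commute)
  qed
  moreover have "(\<lambda>N. M * r N + D * H * S n * p n) \<longlonglongrightarrow> M * 0 + D * H * S n * p n"
    unfolding r_def by (intro tendsto_intros unstable_decay assms(1))
  ultimately show ?thesis
    using LIMSEQ_le_const[of _ "M * 0 + D * H * S n * p n"] by auto
qed

lemma forced_orbit_bound:
  assumes "1 \<le> n" and x: "forced_orbit g n x"
    and bdd: "\<And>k. n \<le> k \<Longrightarrow> norm (x k) \<le> M * p k"
    and g: "\<And>l. n \<le> l \<Longrightarrow> norm (g l) \<le> H * (p l * p l powr q)"
    and "0 \<le> H" "n \<le> k"
  shows "norm (P k (x k)) \<le> (D * (e (n - 1) / p (n - 1)) * norm (P n (x n)) + D * H * S n) * p k"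
    and "norm (Q k (x k)) \<le> D * H * S n * p k"
    and "norm (x k) \<le> (D * (e (n - 1) / p (n - 1)) * norm (P n (x n)) + 2 * (D * H * S n)) * p k"
proof -
  show 1: "norm (P k (x k)) \<le> (D * (e (n - 1) / p (n - 1)) * norm (P n (x n)) + D * H * S n) * p k"
    by (rule stable_estimate) (use assms in \<open>auto simp: forced_orbit_def\<close>)
  have "norm (Q k (x k)) \<le> D * H * S k * p k"
    by (rule unstable_estimate[of _ _ _ M]) (use assms in \<open>auto simp: forced_orbit_def\<close>)
  also have "\<dots> \<le> D * H * S n * p k"
    by (intro mult_right_mono mult_left_mono S_antimono) (use assms D_ge p_pos[of k] in auto)
  finally show 2: "norm (Q k (x k)) \<le> D * H * S n * p k" .
  have "norm (x k) \<le> norm (P k (x k)) + norm (Q k (x k))"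
    by (metis P_add_Q norm_triangle_ineq)
  then show "norm (x k) \<le> (D * (e (n - 1) / p (n - 1)) * norm (P n (x n)) + 2 * (D * H * S n)) * p k"
    using 1 2 by (simp add: algebra_simps)
qed

text \<open>
  The stable part \<open>s\<close> is propagated forwards from \<open>\<xi>\<close>; the unstable part has to be minus the series
  found above, whose terms at time \<open>m\<close> are the \<open>t m j\<close>, \<open>j\<close> being the delay \<open>l - m\<close>.
\<close>

lemma forced_orbit_exists:
  assumes "1 \<le> n" and "P n \<xi> = \<xi>"
    and g: "\<And>l. n \<le> l \<Longrightarrow> norm (g l) \<le> H * (p l * p l powr q)"
    and "0 \<le> H"
  obtains x M where "forced_orbit g n x" "P n (x n) = \<xi>" "\<And>k. n \<le> k \<Longrightarrow> norm (x k) \<le> M * p k"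
proof -
  define s where "s = rec_nat \<xi> (\<lambda>j y. A (n + j) y + P (Suc (n + j)) (g (n + j)))"
  define t where "t m j = W (Suc (j + m)) m (Q (Suc (j + m)) (g (j + m)))" for m j
  define x where "x k = s (k - n) - (\<Sum>j. t k j)" for k
  have t_le: "norm (t k j) \<le> D * H * p k * (e (j + k) * p (j + k) powr q)" if "n \<le> k" for k j
    unfolding t_def by (rule unstable_forcing_bound) (use that assms in auto)
  have t_maj: "summable (\<lambda>j. D * H * p k * (e (j + k) * p (j + k) powr q))" for k
    by (intro summable_mult summable_tail)
  have t_sum: "summable (t k)" if "n \<le> k" for k
    by (rule summable_comparison_test'[OF t_maj t_le[OF that]])
  have t_norm: "norm (suminf (t k)) \<le> D * H * S n * p k" if "n \<le> k" for k
  proof -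
    have "norm (suminf (t k)) \<le> (\<Sum>j. D * H * p k * (e (j + k) * p (j + k) powr q))"
      by (rule norm_suminf_le[OF t_le[OF that] t_maj])
    also have "\<dots> = D * H * p k * S k"
      unfolding S_def by (rule suminf_mult[OF summable_tail])
    also have "\<dots> \<le> D * H * p k * S n"
      by (intro mult_left_mono S_antimono that) (use assms D_ge p_pos[of k] in auto)
    finally show ?thesis by (simp add: mult_ac)
  qed
  have s_Suc: "s (Suc k - n) = A k (s (k - n)) + P (Suc k) (g k)" if "n \<le> k" for k
    using that by (simp add: s_def Suc_diff_le)
  have s_P: "P k (s (k - n)) = s (k - n)" if "n \<le> k" for k
    using that
  proof (induction k rule: dec_induct)
    case base
    show ?case using assms by (simp add: s_def)
  next
    case (step k)
    then show ?case
      using s_Suc[of k] \<open>1 \<le> n\<close> by (simp add: blinfun.add_right P_A P_P)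
  qed
  have t_Suc: "A k (suminf (t k)) = suminf (t (Suc k)) + Q (Suc k) (g k)" if "n \<le> k" for k
  proof -
    have A_t: "(\<lambda>j. A k (t k j)) = (\<lambda>j. W (Suc (j + k)) (Suc k) (Q (Suc (j + k)) (g (j + k))))"
      unfolding t_def using that \<open>1 \<le> n\<close> by (intro ext A_W) auto
    have "A k (suminf (t k)) = (\<Sum>j. A k (t k j))"
      by (rule bounded_linear.suminf[OF blinfun.bounded_linear_right t_sum[OF that]])
    also note A_t
    also have "(\<Sum>j. W (Suc (j + k)) (Suc k) (Q (Suc (j + k)) (g (j + k)))) = (\<Sum>j. W (Suc (Suc j + k)) (Suc k) (Q (Suc (Suc j + k)) (g (Suc j + k))))
        + W (Suc (0 + k)) (Suc k) (Q (Suc (0 + k)) (g (0 + k)))"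
    proof -
      have "summable (\<lambda>j. W (Suc (j + k)) (Suc k) (Q (Suc (j + k)) (g (j + k))))"
        using bounded_linear.summable[OF blinfun.bounded_linear_right t_sum[OF that], of "A k"]
        unfolding A_t .
      then show ?thesis
        using suminf_split_head[of "\<lambda>j. W (Suc (j + k)) (Suc k) (Q (Suc (j + k)) (g (j + k)))"]
        by (simp only: add_Suc add_0 diff_add_cancel)
    qed
    also have "(\<Sum>j. W (Suc (Suc j + k)) (Suc k) (Q (Suc (Suc j + k)) (g (Suc j + k)))) = suminf (t (Suc k))"
      unfolding t_def by simp
    also have "W (Suc (0 + k)) (Suc k) (Q (Suc (0 + k)) (g (0 + k))) = Q (Suc k) (g k)"
      using W_same by simp
    finally show ?thesis .
  qed
  have orbit: "forced_orbit g n x"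
    unfolding forced_orbit_def
  proof safe
    fix k assume "n \<le> k"
    then have "x (Suc k) = A k (s (k - n)) + P (Suc k) (g k) + Q (Suc k) (g k) - A k (suminf (t k))"
      unfolding x_def using s_Suc[of k] t_Suc[of k] by simp
    then show "x (Suc k) = A k (x k) + g k"
      unfolding x_def by (simp add: blinfun.diff_right Q_apply)
  qed
  have Pt: "P k (suminf (t k)) = 0" if "n \<le> k" for k
  proof -
    have "P k (suminf (t k)) = (\<Sum>j. P k (t k j))"
      by (rule bounded_linear.suminf[OF blinfun.bounded_linear_right t_sum[OF that]])
    also have "\<dots> = 0"
      unfolding t_def using that \<open>1 \<le> n\<close> by (simp add: P_W P_Q del: evol.simps)
    finally show ?thesis .
  qed
  have x_n: "P n (x n) = \<xi>"
    using Pt[of n] s_P[of n] by (simp add: x_def blinfun.diff_right s_def)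
  have bdd: "norm (x k) \<le> (D * (e (n - 1) / p (n - 1)) * norm \<xi> + D * H * S n + D * H * S n) * p k"
    if "n \<le> k" for k
  proof -
    have "P k (x k) = s (k - n)"
      using Pt[OF that] s_P[OF that] by (simp add: x_def blinfun.diff_right)
    moreover have "norm (P k (x k)) \<le> (D * (e (n - 1) / p (n - 1)) * norm (P n (x n)) + D * H * S n) * p k"
      by (rule stable_estimate) (use that assms orbit in \<open>auto simp: forced_orbit_def\<close>)
    moreover have "norm (x k) \<le> norm (s (k - n)) + norm (suminf (t k))"
      unfolding x_def by (rule norm_triangle_ineq4)
    ultimately show ?thesis
      using t_norm[OF that] x_n by (simp add: algebra_simps)
  qed
  show ?thesis using that[OF orbit x_n bdd] .
qed

end

section \<open>Decaying orbits of the perturbed equation\<close>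

text \<open>
  Cauchy sequences converge uniformly, and uniform limits stay bounded and continuous. The domain will
  be the discrete space \<^typ>\<open>nat\<close>, which makes this the completeness of the space of bounded sequences.
\<close>

lemma complete_UNIV_bcontfun:
  "complete (UNIV :: ('b::topological_space \<Rightarrow>\<^sub>C 'c::complete_space) set)"
proof (rule completeI)
  fix h :: "nat \<Rightarrow> 'b \<Rightarrow>\<^sub>C 'c" assume "Cauchy h"
  then have "uniformly_Cauchy_on UNIV (\<lambda>i. apply_bcontfun (h i))"
    unfolding uniformly_Cauchy_on_def by (meson dist_fun_lt_imp_dist_val_lt metric_CauchyD)
  then obtain l where "uniform_limit UNIV (\<lambda>i. apply_bcontfun (h i)) l sequentially"
    using Cauchy_uniformly_convergent uniformly_convergent_on_def by blast
  then show "\<exists>l\<in>UNIV. h \<longlonglongrightarrow> l"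
    by (rule uniform_limit_bcontfunE[OF _ sequentially_bot]) auto
qed

locale perturbed_dichotomy = weighted_dichotomy A P p e D q
  for A :: "nat \<Rightarrow> 'a::banach \<Rightarrow>\<^sub>L 'a" and P p e D q +
  fixes f :: "nat \<Rightarrow> 'a \<Rightarrow> 'a" and c C :: real
  assumes f_zero: "\<And>m. m \<ge> 1 \<Longrightarrow> f m 0 = 0"
    and f_diff: "\<And>m u v. m \<ge> 1 \<Longrightarrow>
          norm (f m u - f m v) \<le> c * norm (u - v) * (norm u + norm v) powr q"
    and c_pos: "c > 0" and q_pos: "q > 0" and C_gt: "C > D"
begin

abbreviation F :: "nat \<Rightarrow> nat \<Rightarrow> 'a \<Rightarrow> 'a" where "F \<equiv> nonlinear_evol A f"

text \<open>
  On orbits bounded by \<open>M * p k\<close> from time \<open>n\<close> on, the nonlinearity acts in the weighted norm with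
  size \<open>\<kappa> n M\<close>, once through the stable and once through the unstable part.
\<close>

definition \<kappa> :: "nat \<Rightarrow> real \<Rightarrow> real" where
  "\<kappa> n M = c * D * (2 * M) powr q * S n"

text \<open>
  This condition has two uses: it implies \<open>2 * \<kappa> n M < 1\<close>, and it says that the linear constant \<open>D\<close>
  grows at most to \<open>D / (1 - 2 * \<kappa> n M) \<le> C\<close> when the nonlinearity is absorbed.
\<close>

definition small :: "nat \<Rightarrow> real \<Rightarrow> bool" where
  "small n M \<longleftrightarrow> 0 \<le> M \<and> D + 2 * \<kappa> n M * C \<le> C"

definition decaying :: "nat \<Rightarrow> real \<Rightarrow> 'a \<Rightarrow> bool" where
  "decaying n M v \<longleftrightarrow> (\<forall>k\<ge>n. norm (F k n v) \<le> M * p k)"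

lemma C_pos: "C > 0" using C_gt D_ge by linarith

lemma \<kappa>_nonneg: "\<kappa> n M \<ge> 0"
  unfolding \<kappa>_def using c_pos D_ge S_pos[of n] by simp

lemma \<kappa>_mono:
  assumes "0 \<le> M" "M \<le> N" "n \<le> m"
  shows "\<kappa> m M \<le> \<kappa> n N"
  unfolding \<kappa>_def
  by (intro mult_mono powr_mono2 S_antimono) (use assms c_pos D_ge q_pos S_pos[of m] in auto)

lemma small_mono:
  assumes "small n N" "0 \<le> M" "M \<le> N" "n \<le> m"
  shows "small m M"
proof -
  have "2 * \<kappa> m M * C \<le> 2 * \<kappa> n N * C"
    by (intro mult_right_mono mult_left_mono \<kappa>_mono) (use assms C_pos in auto)
  then show ?thesis using assms by (simp add: small_def)
qed

lemma small_max: "small n M \<Longrightarrow> small n N \<Longrightarrow> small n (max M N)"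
  by (simp add: max_def)

lemma small_contraction:
  assumes "small n M"
  shows "2 * \<kappa> n M < 1"
proof -
  have "2 * \<kappa> n M * C < 1 * C" using assms D_ge by (simp add: small_def)
  then show ?thesis using C_pos mult_less_cancel_right_pos by blast
qed

lemma F_Suc: "n \<le> k \<Longrightarrow> F (Suc k) n v = A k (F k n v) + f k (F k n v)"
  by simp

lemma F_zero: "n \<ge> 1 \<Longrightarrow> F m n 0 = 0"
proof (induction m)
  case (Suc m)
  then show ?case using f_zero by simp
qed simp

lemma decaying_zero: "n \<ge> 1 \<Longrightarrow> 0 \<le> M \<Longrightarrow> decaying n M 0"
  unfolding decaying_def using F_zero less_imp_le[OF p_pos] by simp

lemma decaying_mono: "decaying n M v \<Longrightarrow> M \<le> N \<Longrightarrow> decaying n N v"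
  unfolding decaying_def using p_pos by (meson less_imp_le mult_right_mono order_trans)

text \<open>
  The bounds in this form are the forcing bounds required for the inhomogeneous linear equation.
\<close>

lemma f_diff_weighted:
  assumes "1 \<le> l" "norm u \<le> M * p l" "norm v \<le> M * p l" "norm (u - v) \<le> B * p l" "0 \<le> M"
  shows "norm (f l u - f l v) \<le> c * (2 * M) powr q * B * (p l * p l powr q)"
proof -
  have "(norm u + norm v) powr q \<le> (2 * M * p l) powr q"
    by (intro powr_mono2) (use assms q_pos in auto)
  also have "\<dots> = (2 * M) powr q * p l powr q"
    using assms p_pos[of l] by (simp add: powr_mult)
  finally have "c * norm (u - v) * (norm u + norm v) powr q
      \<le> c * (B * p l) * ((2 * M) powr q * p l powr q)"
    by (intro mult_mono) (use assms c_pos order_trans[OF norm_ge_zero assms(4)] in auto)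
  then show ?thesis using f_diff[OF assms(1), of u v] by (simp add: mult_ac)
qed

lemma f_weighted:
  assumes "1 \<le> l" "norm u \<le> M * p l" "0 \<le> M"
  shows "norm (f l u) \<le> c * (2 * M) powr q * M * (p l * p l powr q)"
  using f_diff_weighted[of l u M 0 M] assms f_zero[of l] p_pos[of l] by simp

text \<open>
  Let \<open>B\<close> be the weighted supremum norm of the difference; it is finite because both orbits decay.
  Regarding the difference as a forced orbit gives \<open>B \<le> D * L + 2 * \<kappa> n M * B\<close>, hence \<open>B \<le> C * L\<close>,
  and inserting this once more bounds the stable and unstable parts. With \<open>w = 0\<close> the estimate also
  bounds a single decaying orbit in terms of its initial stable part.
\<close>

lemma decaying_diff:
  assumes n: "1 \<le> n" and small: "small n M" and v: "decaying n M v" and w: "decaying n M w"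
    and k: "n \<le> k"
  defines "L \<equiv> e (n - 1) / p (n - 1) * norm (P n (v - w))"
  shows "norm (F k n v - F k n w) \<le> C * L * p k"
    and "norm (P k (F k n v - F k n w)) \<le> C * L * p k"
    and "norm (Q k (F k n v - F k n w)) \<le> \<kappa> n M * C * L * p k"
proof -
  define x where "x k = F k n v - F k n w" for k
  define g where "g k = f k (F k n v) - f k (F k n w)" for k
  define R where "R k = norm (x k) / p k" for k
  define B where "B = (SUP k\<in>{n..}. R k)"
  have M: "0 \<le> M" using small by (simp add: small_def)
  have L: "0 \<le> L" unfolding L_def using e_pos[of "n-1"] p_pos[of "n-1"] by simp
  have orbit: "forced_orbit g n x"
    unfolding forced_orbit_def x_def g_def by (simp add: blinfun.diff_right)
  have x_n: "x n = v - w" by (simp add: x_def)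
  have x_le: "norm (x k) \<le> 2 * M * p k" if "n \<le> k" for k
    using norm_triangle_le_diff[of "F k n v" "F k n w" "2 * M * p k"] v w that
    unfolding decaying_def x_def by fastforce
  have R_le: "R k \<le> 2 * M" if "n \<le> k" for k
    using x_le[OF that] p_pos[of k] by (simp add: R_def divide_le_eq)
  have bdd: "bdd_above (R ` {n..})"
    using R_le by (intro bdd_aboveI[of _ "2 * M"]) auto
  have x_B: "norm (x k) \<le> B * p k" if "n \<le> k" for k
  proof -
    have "R k \<le> B" unfolding B_def using that bdd by (intro cSUP_upper) auto
    then show ?thesis using p_pos[of k] by (simp add: R_def divide_le_eq)
  qed
  have B: "0 \<le> B"
    using order_trans[OF norm_ge_zero x_B[of n]] p_pos[of n] by (simp add: zero_le_mult_iff)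
  have g_le: "norm (g l) \<le> c * (2 * M) powr q * B * (p l * p l powr q)" if "n \<le> l" for l
    unfolding g_def
    by (rule f_diff_weighted) (use that n v w x_B[OF that] M in \<open>auto simp: decaying_def x_def\<close>)
  have H: "0 \<le> c * (2 * M) powr q * B" using c_pos B by simp
  have \<kappa>: "D * (c * (2 * M) powr q * B) * S n = \<kappa> n M * B" by (simp add: \<kappa>_def)
  have DL: "D * (e (n - 1) / p (n - 1)) * norm (P n (x n)) = D * L" by (simp add: L_def x_n)
  have est: "norm (P k (x k)) \<le> (D * L + \<kappa> n M * B) * p k"
      "norm (Q k (x k)) \<le> \<kappa> n M * B * p k"
      "norm (x k) \<le> (D * L + 2 * (\<kappa> n M * B)) * p k" if "n \<le> k" for k
    using forced_orbit_bound[OF n orbit x_le g_le H, of k] that unfolding \<kappa> DL by auto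
  have R_le_B: "R k \<le> D * L + 2 * (\<kappa> n M * B)" if "n \<le> k" for k
    using est(3)[OF that] p_pos[of k] by (simp add: R_def divide_le_eq)
  have "B \<le> D * L + 2 * (\<kappa> n M * B)"
    by (subst B_def, rule cSUP_least) (use R_le_B in auto)
  then have "B * (1 - 2 * \<kappa> n M) \<le> D * L" by (simp add: algebra_simps)
  also have "\<dots> \<le> (C - 2 * \<kappa> n M * C) * L"
    by (rule mult_right_mono) (use small L in \<open>auto simp: small_def\<close>)
  also have "\<dots> = C * L * (1 - 2 * \<kappa> n M)" by (simp add: algebra_simps)
  finally have BL: "B \<le> C * L"
    using small_contraction[OF small] by (simp add: mult_le_cancel_right)
  show 1: "norm (F k n v - F k n w) \<le> C * L * p k"
    using x_B[OF k] mult_right_mono[OF BL, of "p k"] p_pos[of k] unfolding x_def by linarith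
  have \<kappa>B: "\<kappa> n M * B \<le> \<kappa> n M * C * L"
    using mult_left_mono[OF BL \<kappa>_nonneg[of n M]] by (simp add: mult_ac)
  have "norm (Q k (x k)) \<le> \<kappa> n M * B * p k" using est(2)[OF k] .
  also have "\<dots> \<le> \<kappa> n M * C * L * p k"
    by (rule mult_right_mono[OF \<kappa>B]) (use p_pos[of k] in auto)
  finally show "norm (Q k (F k n v - F k n w)) \<le> \<kappa> n M * C * L * p k" by (simp add: x_def)
  have "norm (P k (x k)) \<le> (D * L + \<kappa> n M * B) * p k" using est(1)[OF k] .
  also have "\<dots> \<le> C * L * p k"
  proof (rule mult_right_mono)
    have "D * L + \<kappa> n M * B \<le> (D + \<kappa> n M * C) * L" using \<kappa>B by (simp add: algebra_simps)
    also have "\<dots> \<le> C * L"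
      by (rule mult_right_mono[OF _ L])
        (use small mult_nonneg_nonneg[OF \<kappa>_nonneg[of n M] less_imp_le[OF C_pos]] in \<open>simp add: small_def\<close>)
    finally show "D * L + \<kappa> n M * B \<le> C * L" .
  qed (use p_pos[of k] in auto)
  finally show "norm (P k (F k n v - F k n w)) \<le> C * L * p k" by (simp add: x_def)
qed

lemma decaying_unique:
  assumes "1 \<le> n" "small n M" "decaying n M v" "decaying n M w" "P n v = P n w"
  shows "v = w"
  using decaying_diff(1)[OF assms(1-4) order_refl] assms(5) by (simp add: blinfun.diff_right)

lemma bcontfun_of_bounded_seq:
  fixes x :: "nat \<Rightarrow> 'a"
  assumes "\<And>k. norm (x k) \<le> M"
  obtains y where "apply_bcontfun y = x" "norm y \<le> M"
proof -
  have "x \<in> bcontfun"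
    by (rule bcontfun_normI[of _ M]) (use assms in auto)
  then show ?thesis
    using that[of "Bcontfun x"] assms norm_bound[of "Bcontfun x" M]
    by (simp add: Bcontfun_inverse)
qed

text \<open>
  In the ball of radius \<open>M\<close> of bounded sequences \<open>y\<close>, consider the map that sends \<open>y\<close> to the weighted
  bounded solution of the linear equation with forcing \<open>f l (p l * y l)\<close> and stable part \<open>\<xi>\<close> at
  time \<open>n\<close>. It is a contraction with constant \<open>2 * \<kappa> n M\<close>, and its fixed point is a decaying orbit.
\<close>

lemma decaying_exists:
  assumes n: "1 \<le> n" and small: "small n M" and \<xi>: "P n \<xi> = \<xi>"
    and le: "C * (e (n - 1) / p (n - 1) * norm \<xi>) \<le> M"
  obtains v where "P n v = \<xi>" "decaying n M v"
proof -
  define g where "g y l = f l (p l *\<^sub>R apply_bcontfun y l)" for y :: "nat \<Rightarrow>\<^sub>C 'a" and l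
  define H where "H = c * (2 * M) powr q"
  have M: "0 \<le> M" using small by (simp add: small_def)
  have H: "0 \<le> H" using c_pos by (simp add: H_def)
  have \<kappa>: "D * (H * B) * S n = \<kappa> n M * B" for B by (simp add: \<kappa>_def H_def)
  have y_le: "norm (p l *\<^sub>R apply_bcontfun y l) \<le> B * p l" if "norm y \<le> B" for y :: "nat \<Rightarrow>\<^sub>C 'a" and l B
    using order_trans[OF norm_bounded[of y l] that] p_pos[of l] by (simp add: mult.commute)
  have g_le: "norm (g y l) \<le> H * M * (p l * p l powr q)" if "norm y \<le> M" "n \<le> l" for y l
    unfolding g_def H_def by (rule f_weighted) (use y_le that n M in auto)
  have g_diff: "norm (g y l - g z l) \<le> H * norm (y - z) * (p l * p l powr q)"
    if "norm y \<le> M" "norm z \<le> M" "n \<le> l" for y z l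
    unfolding g_def H_def
  proof (rule f_diff_weighted)
    show "norm (p l *\<^sub>R apply_bcontfun y l - p l *\<^sub>R apply_bcontfun z l) \<le> norm (y - z) * p l"
      using y_le[of "y - z" "norm (y - z)" l] by (simp add: scaleR_diff_right)
  qed (use y_le that n M in auto)
  have "\<exists>x. norm y \<le> M \<longrightarrow> forced_orbit (g y) n x \<and> P n (x n) = \<xi> \<and> (\<exists>R. \<forall>k\<ge>n. norm (x k) \<le> R * p k)" for y
  proof (cases "norm y \<le> M")
    case True
    show ?thesis
      using forced_orbit_exists[OF n \<xi> g_le[OF True]] H M by (metis mult_nonneg_nonneg)
  qed auto
  then obtain X where X: "\<And>y. norm y \<le> M \<Longrightarrow> forced_orbit (g y) n (X y)"
      "\<And>y. norm y \<le> M \<Longrightarrow> P n (X y n) = \<xi>"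
      "\<And>y. norm y \<le> M \<Longrightarrow> \<exists>R. \<forall>k\<ge>n. norm (X y k) \<le> R * p k"
    by metis
  have X_le: "norm (X y k) \<le> M * p k" if y: "norm y \<le> M" and k: "n \<le> k" for y k
  proof -
    obtain R where "\<And>k. n \<le> k \<Longrightarrow> norm (X y k) \<le> R * p k" using X(3)[OF y] by auto
    from forced_orbit_bound(3)[OF n X(1)[OF y] this g_le[OF y], of k]
    have "norm (X y k) \<le> (D * (e (n - 1) / p (n - 1)) * norm \<xi> + 2 * (\<kappa> n M * M)) * p k"
      using H M k X(2)[OF y] by (simp add: \<kappa>)
    also have "\<dots> \<le> M * p k"
    proof (rule mult_right_mono)
      have "C * (D * (e (n - 1) / p (n - 1)) * norm \<xi> + 2 * (\<kappa> n M * M))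
          = D * (C * (e (n - 1) / p (n - 1) * norm \<xi>)) + 2 * \<kappa> n M * C * M"
        by (simp add: algebra_simps)
      also have "\<dots> \<le> D * M + 2 * \<kappa> n M * C * M"
        using mult_left_mono[OF le, of D] D_ge by simp
      also have "\<dots> \<le> C * M"
        using mult_right_mono[of "D + 2 * \<kappa> n M * C" C M] small M
        by (simp add: small_def distrib_right)
      finally show "D * (e (n - 1) / p (n - 1)) * norm \<xi> + 2 * (\<kappa> n M * M) \<le> M"
        using C_pos by (simp add: mult_le_cancel_left)
    qed (use p_pos[of k] in auto)
    finally show ?thesis .
  qed
  have X_diff: "norm (X y k - X z k) \<le> 2 * \<kappa> n M * norm (y - z) * p k"
    if y: "norm y \<le> M" and z: "norm z \<le> M" and k: "n \<le> k" for y z k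
  proof -
    have orb: "forced_orbit (\<lambda>l. g y l - g z l) n (\<lambda>k. X y k - X z k)"
      using X(1)[OF y] X(1)[OF z] by (simp add: forced_orbit_def blinfun.diff_right)
    have bd: "norm (X y k - X z k) \<le> 2 * M * p k" if "n \<le> k" for k
      using norm_triangle_le_diff[of "X y k" "X z k" "2 * M * p k"] X_le[OF y that] X_le[OF z that]
      by simp
    from forced_orbit_bound(3)[OF n orb bd g_diff[OF y z], of k]
    have "norm (X y k - X z k) \<le> 2 * (\<kappa> n M * norm (y - z)) * p k"
      using H k X(2)[OF y] X(2)[OF z] by (simp add: \<kappa> blinfun.diff_right)
    then show ?thesis by (simp add: mult.assoc)
  qed
  \<comment> \<open>Zero entries before time \<open>n\<close> keep the whole sequence bounded by \<open>M\<close>.\<close>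
  have "\<exists>w. norm y \<le> M \<longrightarrow> apply_bcontfun w = (\<lambda>k. if n \<le> k then X y k /\<^sub>R p k else 0) \<and> norm w \<le> M" for y
  proof (cases "norm y \<le> M")
    case True
    have "norm (if n \<le> k then X y k /\<^sub>R p k else 0) \<le> M" for k
      using X_le[OF True, of k] p_pos[of k] M by (simp add: divide_simps mult.commute)
    then obtain w where "apply_bcontfun w = (\<lambda>k. if n \<le> k then X y k /\<^sub>R p k else 0)" "norm w \<le> M"
      using bcontfun_of_bounded_seq[of "\<lambda>k. if n \<le> k then X y k /\<^sub>R p k else 0"] by blast
    then show ?thesis by blast
  qed auto
  then obtain T where T: "\<And>y. norm y \<le> M \<Longrightarrow> apply_bcontfun (T y) = (\<lambda>k. if n \<le> k then X y k /\<^sub>R p k else 0)"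
      "\<And>y. norm y \<le> M \<Longrightarrow> norm (T y) \<le> M"
    by metis
  have T_diff: "dist (T y) (T z) \<le> 2 * \<kappa> n M * dist y z" if y: "norm y \<le> M" and z: "norm z \<le> M" for y z
    unfolding dist_norm
  proof (rule norm_bound)
    fix k
    show "norm (apply_bcontfun (T y - T z) k) \<le> 2 * \<kappa> n M * norm (y - z)"
    proof (cases "n \<le> k")
      case True
      have "apply_bcontfun (T y - T z) k = (X y k - X z k) /\<^sub>R p k"
        using T y z True by (simp add: scaleR_diff_right)
      then show ?thesis
        using X_diff[OF y z True] p_pos[of k] by (simp add: divide_simps mult.commute)
    next
      case False
      then show ?thesis using T y z \<kappa>_nonneg[of n M] by simp
    qed
  qed
  have "\<exists>!y\<in>cball 0 M. T y = y"
  proof (rule Banach_fix)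
    show "complete (cball (0::nat \<Rightarrow>\<^sub>C 'a) M)" 
      by (rule complete_closed_subset[OF closed_cball subset_UNIV complete_UNIV_bcontfun])
    show "cball (0::nat \<Rightarrow>\<^sub>C 'a) M \<noteq> {}" using M by simp
    show "0 \<le> 2 * \<kappa> n M" "2 * \<kappa> n M < 1" using \<kappa>_nonneg small_contraction[OF small] by auto
    show "T ` cball 0 M \<subseteq> cball 0 M" using T by auto
    show "\<And>y z. y \<in> cball 0 M \<Longrightarrow> z \<in> cball 0 M \<Longrightarrow> dist (T y) (T z) \<le> 2 * \<kappa> n M * dist y z"
      using T_diff by simp
  qed
  then obtain y where y: "norm y \<le> M" "T y = y" by auto
  have yX: "p k *\<^sub>R apply_bcontfun y k = X y k" if "n \<le> k" for k
    using T(1)[OF y(1)] y(2) that p_pos[of k] by simp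
  have F_X: "F k n (X y n) = X y k" if "n \<le> k" for k
    using that
  proof (induction k rule: dec_induct)
    case (step k)
    then show ?case using X(1)[OF y(1)] yX[of k] by (simp add: forced_orbit_def g_def)
  qed simp
  show ?thesis
    using that[of "X y n"] X(2)[OF y(1)] X_le[OF y(1)] F_X by (simp add: decaying_def)
qed

end

section \<open>The graph of decaying orbits\<close>

text \<open>
  The two smallness conditions on \<open>\<delta>\<close> ensure, respectively, that the orbits issued from the balls of
  radius \<open>\<delta> * \<beta> n\<close> fall under the contraction argument, and that the graph has Lipschitz constant \<open>1\<close>.
\<close>

locale invariant_graph = perturbed_dichotomy A P p e D q f c C
  for A :: "nat \<Rightarrow> 'a::banach \<Rightarrow>\<^sub>L 'a" and P p e D q f c C +
  fixes \<beta> :: "nat \<Rightarrow> real" and K \<delta> :: real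
  assumes \<beta>_eq: "\<And>n. 1 \<le> n \<Longrightarrow> \<beta> n = p (n - 1) / (e (n - 1) powr (1 + 1 / q) * S n powr (1 / q))"
    and K_ge: "K \<ge> 1"
    and \<beta>_K: "\<And>n m. 1 \<le> n \<Longrightarrow> n \<le> m \<Longrightarrow> p m / \<beta> m \<le> K * (p (n - 1) / \<beta> n)"
    and \<delta>_pos: "\<delta> > 0"
    and \<delta>_contraction: "D + 2 * (c * D * (4 * C * \<delta>) powr q) * C \<le> C"
    and \<delta>_lipschitz: "c * D * (4 * C * \<delta>) powr q * C \<le> 1"
begin

text \<open>
  A decaying orbit whose stable part at time \<open>n\<close> is smaller than \<open>\<delta> * \<beta> n\<close> is bounded by \<open>R n / 2 * p k\<close>. The
  factor 2 leaves room for the orbits on the graph of a competitor, where only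
  \<open>norm x \<le> 2 * norm (P k x)\<close> is available.
\<close>

definition R :: "nat \<Rightarrow> real" where
  "R n = 2 * C * (e (n - 1) / p (n - 1) * (\<delta> * \<beta> n))"

text \<open>Unique by \<open>decaying_unique\<close> when \<open>\<xi>\<close> lies in the ball of radius \<open>\<delta> * \<beta> n\<close>.\<close>

definition start :: "nat \<Rightarrow> 'a \<Rightarrow> 'a" where
  "start n \<xi> = (SOME v. P n v = \<xi> \<and> decaying n (R n) v)"

definition \<phi> :: "nat \<Rightarrow> 'a \<Rightarrow> 'a" where
  "\<phi> n \<xi> = Q n (start n \<xi>)"

abbreviation outer_ball :: "nat \<Rightarrow> 'a set" where
  "outer_ball n \<equiv> stable_ball P n (\<delta> * \<beta> n)"

abbreviation inner_ball :: "nat \<Rightarrow> 'a set" where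
  "inner_ball n \<equiv> stable_ball P n (\<delta> / (C * K) * (\<beta> n / e (n - 1)))"

lemma \<beta>_pos: "1 \<le> n \<Longrightarrow> \<beta> n > 0"
  using \<beta>_eq[of n] p_pos[of "n-1"] e_pos[of "n-1"] S_pos[of n] by simp

lemma R_nonneg: "1 \<le> n \<Longrightarrow> R n \<ge> 0"
  unfolding R_def using \<beta>_pos[of n] p_pos[of "n-1"] e_pos[of "n-1"] \<delta>_pos C_pos by simp

text \<open>
  This identity explains the definition of \<open>\<beta>\<close>: the powers of \<open>p (n - 1)\<close> and \<open>S n\<close> cancel, and one
  factor \<open>1 / e (n - 1)\<close> is left over.
\<close>

lemma \<kappa>_R:
  assumes "1 \<le> n"
  shows "\<kappa> n (R n) = c * D * (4 * C * \<delta>) powr q / e (n - 1)"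
proof -
  have "2 * R n = (4 * C * \<delta>) * (1 / (e (n - 1) powr (1 / q) * S n powr (1 / q)))"
    unfolding R_def \<beta>_eq[OF assms] powr_add
    using p_pos[of "n-1"] e_pos[of "n-1"] S_pos[of n] by (simp add: field_simps)
  then have "(2 * R n) powr q = (4 * C * \<delta>) powr q * (1 / (e (n - 1) * S n))"
    using C_pos \<delta>_pos e_pos[of "n-1"] S_pos[of n] q_pos
    by (simp add: powr_mult powr_divide powr_powr)
  then show ?thesis
    unfolding \<kappa>_def using S_pos[of n] by simp
qed

lemma \<kappa>_R_le:
  assumes "1 \<le> n"
  shows "\<kappa> n (R n) \<le> c * D * (4 * C * \<delta>) powr q"
proof -
  have "c * D * (4 * C * \<delta>) powr q / e (n - 1) \<le> c * D * (4 * C * \<delta>) powr q / 1"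
    by (intro divide_left_mono) (use c_pos D_ge e_ge[of "n-1"] e_pos[of "n-1"] in auto)
  then show ?thesis unfolding \<kappa>_R[OF assms] by simp
qed

lemma small_R:
  assumes "1 \<le> n"
  shows "small n (R n)"
proof -
  have "2 * \<kappa> n (R n) * C \<le> 2 * (c * D * (4 * C * \<delta>) powr q) * C"
    by (intro mult_right_mono mult_left_mono \<kappa>_R_le assms) (use C_pos in auto)
  then show ?thesis
    using \<delta>_contraction R_nonneg[OF assms] by (simp add: small_def)
qed

lemma stable_ball_iff:
  assumes "1 \<le> n"
  shows "\<xi> \<in> stable_ball P n r \<longleftrightarrow> P n \<xi> = \<xi> \<and> norm \<xi> < r"
proof -
  have "\<xi> \<in> stable_space P n \<longleftrightarrow> P n \<xi> = \<xi>"
    unfolding stable_space_def image_iff by (auto simp: P_P[OF assms] intro: exI[of _ \<xi>])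
  then show ?thesis by (simp add: stable_ball_def)
qed

lemma ball_le_R:
  assumes "1 \<le> n" "\<xi> \<in> outer_ball n"
  shows "2 * C * (e (n - 1) / p (n - 1) * norm \<xi>) \<le> R n"
  unfolding R_def using assms C_pos e_pos[of "n-1"] p_pos[of "n-1"]
  by (intro mult_left_mono) (auto simp: stable_ball_def)

lemma start:
  assumes "1 \<le> n" "\<xi> \<in> outer_ball n"
  shows "P n (start n \<xi>) = \<xi>" "decaying n (R n) (start n \<xi>)"
proof -
  have "0 \<le> C * (e (n - 1) / p (n - 1) * norm \<xi>)"
    using C_pos e_pos[of "n-1"] p_pos[of "n-1"] by simp
  then have "C * (e (n - 1) / p (n - 1) * norm \<xi>) \<le> R n"
    using ball_le_R[OF assms] by linarith
  then obtain v where "P n v = \<xi>" "decaying n (R n) v"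
    using decaying_exists[OF assms(1) small_R[OF assms(1)], of \<xi>] assms stable_ball_iff by blast
  then have "\<exists>v. P n v = \<xi> \<and> decaying n (R n) v" by blast
  from someI_ex[OF this] show "P n (start n \<xi>) = \<xi>" "decaying n (R n) (start n \<xi>)"
    by (auto simp: start_def)
qed

lemma start_eq:
  assumes "1 \<le> n" "\<xi> \<in> outer_ball n"
  shows "\<xi> + \<phi> n \<xi> = start n \<xi>"
  using start[OF assms] P_add_Q[of n "start n \<xi>"] by (simp add: \<phi>_def)

text \<open>
  Both the orbit of \<open>v\<close> and the one defining \<open>\<phi>\<close> are bounded by the maximum of \<open>M\<close> and \<open>R n\<close>, so
  \<open>decaying_unique\<close> identifies them. The bound \<open>M\<close> is arbitrary because, for invariance, an orbit is
  restarted at a later time and keeps the bound of its original starting time.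
\<close>

lemma decaying_on_graph:
  assumes n: "1 \<le> n" and v: "P n v \<in> outer_ball n" "decaying n M v" and small: "small n M"
  shows "\<phi> n (P n v) = Q n v"
proof -
  have "start n (P n v) = v"
  proof (rule decaying_unique[OF n])
    show "small n (max M (R n))" using small small_R[OF n] by (rule small_max)
    show "decaying n (max M (R n)) v" using v(2) by (rule decaying_mono) simp
    show "decaying n (max M (R n)) (start n (P n v))"
      using start(2)[OF n v(1)] by (rule decaying_mono) simp
    show "P n (start n (P n v)) = P n v" by (rule start(1)[OF n v(1)])
  qed
  then show ?thesis by (simp add: \<phi>_def)
qed

lemma zero_in_ball: "1 \<le> n \<Longrightarrow> 0 \<in> outer_ball n"
  using stable_ball_iff \<beta>_pos \<delta>_pos by simp

lemma \<phi>_zero: "1 \<le> n \<Longrightarrow> \<phi> n 0 = 0"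
  using decaying_on_graph[of n 0 "R n"] zero_in_ball decaying_zero R_nonneg small_R by simp

lemma orbit_lipschitz:
  assumes "1 \<le> n" "n \<le> m" "\<xi> \<in> outer_ball n" "\<eta> \<in> outer_ball n"
  shows "norm (F m n (\<xi> + \<phi> n \<xi>) - F m n (\<eta> + \<phi> n \<eta>))
    \<le> C * (e (n - 1) / p (n - 1) * norm (\<xi> - \<eta>)) * p m"
  using decaying_diff(1)[OF assms(1) small_R[OF assms(1)] start(2)[OF assms(1,3)] start(2)[OF assms(1,4)] assms(2)]
    start(1)[OF assms(1,3)] start(1)[OF assms(1,4)] start_eq assms
  by (simp add: blinfun.diff_right)

text \<open>
  The loss \<open>e (n - 1)\<close> in the estimate for differences of orbits is cancelled by the factor
  \<open>1 / e (n - 1)\<close> in \<open>\<kappa> n (R n)\<close>.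
\<close>

lemma \<phi>_lipschitz:
  assumes "1 \<le> n" "\<xi> \<in> outer_ball n" "\<eta> \<in> outer_ball n"
  shows "norm (\<phi> n \<xi> - \<phi> n \<eta>) \<le> norm (\<xi> - \<eta>)"
proof -
  define t where "t = c * D * (4 * C * \<delta>) powr q"
  have t: "0 \<le> t" "t * C \<le> 1" using c_pos D_ge \<delta>_lipschitz by (auto simp: t_def)
  have "norm (\<phi> n \<xi> - \<phi> n \<eta>) \<le> \<kappa> n (R n) * C * (e (n - 1) / p (n - 1) * norm (\<xi> - \<eta>)) * p n"
    using decaying_diff(3)[OF assms(1) small_R[OF assms(1)] start(2)[OF assms(1,2)] start(2)[OF assms(1,3)] order_refl]
      start(1)[OF assms(1,2)] start(1)[OF assms(1,3)]
    by (simp add: \<phi>_def blinfun.diff_right)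
  also have "\<dots> = t * C * (p n / p (n - 1)) * norm (\<xi> - \<eta>)"
    unfolding \<kappa>_R[OF assms(1)] t_def using e_pos[of "n-1"] p_pos[of "n-1"] by (simp add: field_simps)
  also have "\<dots> \<le> 1 * 1 * norm (\<xi> - \<eta>)"
    by (intro mult_right_mono mult_mono)
      (use t C_pos p_pos[of n] p_pos[of "n-1"] p_antimono[of "n-1" n] in auto)
  finally show ?thesis by simp
qed

lemma \<phi>_graph_space: "\<phi> \<in> graph_space P \<delta> \<beta>"
  unfolding graph_space_def
proof (intro CollectI allI impI conjI ballI)
  fix n :: nat assume n: "1 \<le> n"
  show "\<phi> n \<in> outer_ball n \<rightarrow> unstable_space P n"
    by (auto simp: \<phi>_def unstable_space_def)
  show "continuous_on (outer_ball n) (\<phi> n)"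
    by (rule lipschitz_on_continuous_on[of 1], rule lipschitz_onI)
      (use \<phi>_lipschitz[OF n] in \<open>auto simp: dist_norm\<close>)
  show "\<phi> n 0 = 0" using \<phi>_zero[OF n] .
qed (use \<phi>_lipschitz in auto)

lemma CK_pos: "C * K > 0"
  using C_pos K_ge by simp

lemma inner_ball_subset: 
  assumes "1 \<le> n"
  shows "inner_ball n \<subseteq> outer_ball n"
proof -
  have "1 \<le> C * (K * e (n - 1))"
    using mult_mono[of 1 C 1 "K * e (n - 1)"] mult_mono[of 1 K 1 "e (n - 1)"] C_gt D_ge K_ge e_ge[of "n-1"]
    by simp
  then have "\<delta> * \<beta> n / (C * (K * e (n - 1))) \<le> \<delta> * \<beta> n / 1"
    by (intro divide_left_mono) (use \<delta>_pos \<beta>_pos[OF assms] in auto)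
  then have "\<delta> / (C * K) * (\<beta> n / e (n - 1)) \<le> \<delta> * \<beta> n" by (simp add: mult.assoc)
  then show ?thesis by (auto simp: stable_ball_def)
qed

text \<open>
  The smaller radius is \<open>\<delta> * \<beta> n\<close> divided by the three constants that an orbit may lose: \<open>C\<close> and
  \<open>e (n - 1)\<close> by the growth estimate, and \<open>K\<close> in comparing \<open>\<beta> n * p m / p (n - 1)\<close> with \<open>\<beta> m\<close>.
\<close>

lemma inner_ball_orbit_radius:
  assumes n: "1 \<le> n" "n \<le> m" and \<xi>: "\<xi> \<in> inner_ball n"
  shows "C * (e (n - 1) / p (n - 1) * norm \<xi>) * p m < \<delta> * \<beta> m"
proof -
  note pos = C_pos K_ge e_pos[of "n-1"] p_pos[of "n-1"] p_pos[of m] \<beta>_pos[of n] \<beta>_pos[of m] \<delta>_pos CK_pos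
  have "norm \<xi> < \<delta> / (C * K) * (\<beta> n / e (n - 1))" using \<xi> by (simp add: stable_ball_def)
  then have "C * (e (n - 1) / p (n - 1) * norm \<xi>) * p m
      < C * (e (n - 1) / p (n - 1) * (\<delta> / (C * K) * (\<beta> n / e (n - 1)))) * p m"
    using pos by (intro mult_strict_right_mono mult_strict_left_mono) auto
  also have "\<dots> = \<delta> / K * (\<beta> n * p m / p (n - 1))"
    using pos n by (simp add: field_simps)
  also have "\<dots> \<le> \<delta> / K * (K * \<beta> m)"
  proof (rule mult_left_mono)
    have "p m * \<beta> n \<le> K * p (n - 1) * \<beta> m"
      using \<beta>_K[OF n] pos n by (simp add: field_simps)
    then show "\<beta> n * p m / p (n - 1) \<le> K * \<beta> m"
      using pos by (simp add: divide_le_eq mult_ac)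
  qed (use pos in auto)
  also have "\<dots> = \<delta> * \<beta> m" using K_ge by simp
  finally show ?thesis .
qed

lemma decaying_F:
  assumes "n \<le> m" "decaying n M v"
  shows "decaying m M (F m n v)"
  using assms nonlinear_evol_trans[of n m _ A f v] unfolding decaying_def by (metis order_trans)

text \<open>
  Restarted at time \<open>m\<close>, a decaying orbit still decays, and its stable part there lies in the ball of
  radius \<open>\<delta> * \<beta> m\<close>; so it is on the graph of \<open>\<phi> m\<close>.
\<close>

lemma \<phi>_invariant: "locally_invariant A f P (\<delta> / (C * K)) (\<lambda>n. \<beta> n / e (n - 1)) \<delta> \<beta> \<phi>"
  unfolding locally_invariant_def local_graph_def
proof safe
  fix n m :: nat and \<xi> assume n: "1 \<le> n" "n \<le> m" and \<xi>: "\<xi> \<in> inner_ball n"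
  have m: "1 \<le> m" using n by simp
  have ball: "\<xi> \<in> outer_ball n" using inner_ball_subset[OF n(1)] \<xi> by auto
  define z where "z = F m n (start n \<xi>)"
  have "norm (P m z) \<le> C * (e (n - 1) / p (n - 1) * norm \<xi>) * p m"
    using decaying_diff(2)[OF n(1) small_R[OF n(1)] start(2)[OF n(1) ball] decaying_zero n(2)]
      start(1)[OF n(1) ball] F_zero[OF n(1)] R_nonneg n by (simp add: z_def)
  also have "\<dots> < \<delta> * \<beta> m" by (rule inner_ball_orbit_radius[OF n \<xi>])
  finally have Pz: "P m z \<in> outer_ball m" using stable_ball_iff[OF m] P_P[OF m] by simp
  moreover have "\<phi> m (P m z) = Q m z"
  proof (rule decaying_on_graph[OF m Pz])
    show "decaying m (R n) z"
      unfolding z_def by (rule decaying_F[OF n(2) start(2)[OF n(1) ball]])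
    show "small m (R n)"
      by (rule small_mono[OF small_R[OF n(1)] R_nonneg[OF n(1)] order_refl n(2)])
  qed
  ultimately show "F m n (\<xi> + \<phi> n \<xi>) \<in> (\<lambda>\<xi>. \<xi> + \<phi> m \<xi>) ` outer_ball m"
    unfolding start_eq[OF n(1) ball] using P_add_Q[of m z] by (intro image_eqI[of _ _ "P m z"]) (auto simp: z_def)
qed

text \<open>
  Invariance keeps the orbit on the graphs of the \<open>\<psi> k\<close>, where \<open>\<psi> k\<close> has Lipschitz constant \<open>1\<close> and
  vanishes at \<open>0\<close>; hence the whole orbit is at most twice its stable part. The stable part at time \<open>k\<close>
  depends only on earlier times, so its decay follows by induction on \<open>k\<close>.
\<close>

lemma invariant_graph_decaying:
  assumes \<psi>: "\<psi> \<in> graph_space P \<delta> \<beta>"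
    and inv: "locally_invariant A f P (\<delta> / (C * K)) (\<lambda>n. \<beta> n / e (n - 1)) \<delta> \<beta> \<psi>"
    and n: "1 \<le> n" and \<xi>: "\<xi> \<in> inner_ball n"
  defines "v \<equiv> \<xi> + \<psi> n \<xi>" and "M \<equiv> 2 * C * (e (n - 1) / p (n - 1) * norm \<xi>)"
  shows "decaying n M v" and "P n v = \<xi>" and "small n M"
proof -
  have ball: "\<xi> \<in> outer_ball n" using inner_ball_subset[OF n(1)] \<xi> by auto
  have M: "0 \<le> M" using C_pos e_pos[of "n-1"] p_pos[of "n-1"] by (simp add: M_def)
  show small: "small n M"
    using small_mono[OF small_R[OF n] M ball_le_R[OF n ball, folded M_def] order_refl] .
  have P_graph: "P k (x + \<psi> k x) = x" if "1 \<le> k" "x \<in> outer_ball k" for k x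
  proof -
    have "\<psi> k x \<in> unstable_space P k" using \<psi> that unfolding graph_space_def by blast
    then show ?thesis
      using that P_Q stable_ball_iff by (auto simp: unstable_space_def blinfun.add_right)
  qed
  have \<psi>_le: "norm (\<psi> k x) \<le> norm x" if "1 \<le> k" "x \<in> outer_ball k" for k x
  proof -
    have "norm (\<psi> k x - \<psi> k 0) \<le> norm (x - 0)" "\<psi> k 0 = 0"
      using \<psi> that zero_in_ball[OF that(1)] unfolding graph_space_def by blast+
    then show ?thesis by simp
  qed
  show Pv: "P n v = \<xi>" unfolding v_def by (rule P_graph[OF n ball])
  have half: "norm (F k n v) \<le> 2 * norm (P k (F k n v))" if k: "n \<le> k" for k
  proof -
    have "v \<in> local_graph P \<psi> n (\<delta> / (C * K)) (\<lambda>n. \<beta> n / e (n - 1))"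
      unfolding v_def local_graph_def using \<xi> by blast
    then have "F k n v \<in> local_graph P \<psi> k \<delta> \<beta>"
      using inv n k unfolding locally_invariant_def by blast
    then obtain x where x: "x \<in> outer_ball k" "F k n v = x + \<psi> k x"
      unfolding local_graph_def by auto
    then show ?thesis
      using \<psi>_le[of k x] P_graph[of k x] norm_triangle_ineq[of x "\<psi> k x"] n k by simp
  qed
  have "norm (P k (F k n v)) \<le> M / 2 * p k" if "n \<le> k" for k
    using that
  proof (induction k rule: less_induct)
    case (less k)
    have z: "norm (F l n v) \<le> M * p l" if "n \<le> l" "l < k" for l
      using less.IH[of l] half[of l] that by simp
    have "norm (P k (F k n v)) \<le> (D * (e (n - 1) / p (n - 1)) * norm (P n (F n n v))
        + D * (c * (2 * M) powr q * M) * S n) * p k"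
    proof (rule stable_estimate[OF n less.prems])
      fix l assume l: "n \<le> l" "l < k"
      show "F (Suc l) n v = A l (F l n v) + f l (F l n v)" by (rule F_Suc[OF l(1)])
      show "norm (f l (F l n v)) \<le> c * (2 * M) powr q * M * (p l * p l powr q)"
        by (rule f_weighted) (use z l n M in auto)
    qed (use c_pos M in auto)
    also have "\<dots> = (D / C * (M / 2) + \<kappa> n M * M) * p k"
    proof -
      have "D * (e (n - 1) / p (n - 1)) * norm \<xi> = D / C * (M / 2)" using C_pos by (simp add: M_def)
      then show ?thesis by (simp add: Pv \<kappa>_def)
    qed
    also have "\<dots> \<le> M / 2 * p k"
    proof (rule mult_right_mono)
      have "D / C * (M / 2) + \<kappa> n M * M = (D + 2 * \<kappa> n M * C) * (M / (2 * C))"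
        using C_pos by (simp add: field_simps)
      also have "\<dots> \<le> C * (M / (2 * C))"
        by (rule mult_right_mono) (use small M C_pos in \<open>auto simp: small_def\<close>)
      finally show "D / C * (M / 2) + \<kappa> n M * M \<le> M / 2" using C_pos by simp
    qed (use p_pos[of k] in auto)
    finally show ?case .
  qed
  then show "decaying n M v" unfolding decaying_def using half by fastforce
qed

lemma \<phi>_unique:
  assumes "\<psi> \<in> graph_space P \<delta> \<beta>"
    and "locally_invariant A f P (\<delta> / (C * K)) (\<lambda>n. \<beta> n / e (n - 1)) \<delta> \<beta> \<psi>"
    and n: "1 \<le> n" and \<xi>: "\<xi> \<in> inner_ball n"
  shows "\<psi> n \<xi> = \<phi> n \<xi>"
proof -
  note v = invariant_graph_decaying[OF assms]
  have "\<phi> n (P n (\<xi> + \<psi> n \<xi>)) = Q n (\<xi> + \<psi> n \<xi>)"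
    by (rule decaying_on_graph[OF n _ v(1,3)]) (use v(2) inner_ball_subset[OF n] \<xi> in auto)
  then show ?thesis using v(2) by (simp add: Q_apply)
qed

end

section \<open>Nonuniform dichotomies\<close>

lemma growth_rate_ge_1:
  assumes "growth_rate \<rho>"
  shows "1 \<le> \<rho> k"
  using assms incseqD[of \<rho> 0 k] unfolding growth_rate_def by fastforce

lemma dichotomy_imp_weighted_dichotomy:
  fixes A :: "nat \<Rightarrow> 'a::banach \<Rightarrow>\<^sub>L 'a"
  assumes inv: "\<And>m. m \<ge> 1 \<Longrightarrow> blinfun_invertible (A m)"
    and \<mu>: "growth_rate \<mu>" and \<nu>: "growth_rate \<nu>"
    and dich: "nonuniform_dichotomy A \<mu> \<nu> P a b \<epsilon> D"
    and decay: "(\<lambda>m. \<mu> m powr a * \<mu> (m - 1) powr (- b) * \<nu> (m - 1) powr \<epsilon>) \<longlonglongrightarrow> 0"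
    and summable: "summable (\<lambda>k. \<mu> (Suc k) powr (a * q) * \<nu> (Suc k) powr \<epsilon>)"
  shows "weighted_dichotomy A P (\<lambda>k. \<mu> k powr a) (\<lambda>k. \<nu> k powr \<epsilon>) D q"
proof -
  have ab: "a < 0" "0 \<le> b" "0 \<le> \<epsilon>" "1 \<le> D"
    and idem: "\<And>m. m \<ge> 1 \<Longrightarrow> P m o\<^sub>L P m = P m"
    and comm: "\<And>m n. 1 \<le> n \<Longrightarrow> n \<le> m \<Longrightarrow> P m o\<^sub>L evol A m n = evol A m n o\<^sub>L P n"
    and stab: "\<And>m n. 1 \<le> n \<Longrightarrow> n \<le> m \<Longrightarrow> norm (evol A m n o\<^sub>L P n) \<le> D * (\<mu> m / \<mu> (n - 1)) powr a * \<nu> (n - 1) powr \<epsilon>"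
    and unst: "\<And>m n. 1 \<le> n \<Longrightarrow> n \<le> m \<Longrightarrow> norm (blinfun_inverse (evol A m n) o\<^sub>L compl_proj (P m))
          \<le> D * (\<mu> (m - 1) / \<mu> n) powr (- b) * \<nu> (m - 1) powr \<epsilon>"
    using dich unfolding nonuniform_dichotomy_def by auto
  have \<mu>_pos: "0 < \<mu> k" for k using growth_rate_ge_1[OF \<mu>, of k] by linarith
  have \<mu>_mono: "\<mu> k \<le> \<mu> l" if "k \<le> l" for k l
    using \<mu> that by (auto simp: growth_rate_def incseqD)
  show ?thesis
  proof
    show "P (Suc m) o\<^sub>L A m = A m o\<^sub>L P m" if "1 \<le> m" for m
      using comm[of m "Suc m"] that by simp
    show "0 < \<mu> k powr a" for k using \<mu>_pos[of k] by simp
    show "\<mu> l powr a \<le> \<mu> k powr a" if "k \<le> l" for k l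
      using powr_mono2'[of a "\<mu> k" "\<mu> l"] ab \<mu>_pos[of k] \<mu>_mono[OF that] by simp
    show "1 \<le> \<nu> k powr \<epsilon>" for k
      using growth_rate_ge_1[OF \<nu>, of k] ab by (intro ge_one_powr_ge_zero) auto
    show "norm (evol A m n o\<^sub>L P n) \<le> D * (\<mu> m powr a / \<mu> (n - 1) powr a) * \<nu> (n - 1) powr \<epsilon>"
      if "1 \<le> n" "n \<le> m" for m n
      using stab[OF that] \<mu>_pos[of m] \<mu>_pos[of "n-1"] by (simp add: powr_divide)
    show "norm (blinfun_inverse (evol A (Suc m) n) o\<^sub>L compl_proj (P (Suc m))) \<le> D * \<nu> m powr \<epsilon>"
      if "1 \<le> n" "n \<le> m" for m n
    proof -
      have "(\<mu> m / \<mu> n) powr (- b) \<le> 1"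
        using powr_mono2'[of "- b" 1 "\<mu> m / \<mu> n"] ab \<mu>_pos[of n] \<mu>_mono[OF that(2)] by simp
      then have "D * (\<mu> m / \<mu> n) powr (- b) * \<nu> m powr \<epsilon> \<le> D * 1 * \<nu> m powr \<epsilon>"
        using ab by (intro mult_right_mono mult_left_mono) auto
      then show ?thesis using unst[of n "Suc m"] that by simp
    qed
    show "(\<lambda>m. norm (blinfun_inverse (evol A m n) o\<^sub>L compl_proj (P m)) * \<mu> m powr a) \<longlonglongrightarrow> 0"
      if "1 \<le> n" for n
    proof (rule tendsto_sandwich[OF _ _ tendsto_const])
      show "(\<lambda>m. D * \<mu> n powr b * (\<mu> m powr a * \<mu> (m - 1) powr (- b) * \<nu> (m - 1) powr \<epsilon>)) \<longlonglongrightarrow> 0"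
        using tendsto_mult_right_zero[OF decay] by simp
      show "\<forall>\<^sub>F m in sequentially. norm (blinfun_inverse (evol A m n) o\<^sub>L compl_proj (P m)) * \<mu> m powr a
          \<le> D * \<mu> n powr b * (\<mu> m powr a * \<mu> (m - 1) powr (- b) * \<nu> (m - 1) powr \<epsilon>)"
      proof (rule eventually_sequentiallyI[of n])
        fix m assume "n \<le> m"
        have "norm (blinfun_inverse (evol A m n) o\<^sub>L compl_proj (P m)) * \<mu> m powr a
            \<le> D * (\<mu> (m - 1) / \<mu> n) powr (- b) * \<nu> (m - 1) powr \<epsilon> * \<mu> m powr a"
          by (intro mult_right_mono unst that \<open>n \<le> m\<close>) auto
        also have "(\<mu> (m - 1) / \<mu> n) powr (- b) = \<mu> (m - 1) powr (- b) * \<mu> n powr b"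
          using \<mu>_pos[of "m-1"] \<mu>_pos[of n] by (simp add: powr_divide powr_minus field_simps)
        finally show "norm (blinfun_inverse (evol A m n) o\<^sub>L compl_proj (P m)) * \<mu> m powr a
          \<le> D * \<mu> n powr b * (\<mu> m powr a * \<mu> (m - 1) powr (- b) * \<nu> (m - 1) powr \<epsilon>)"
          by (simp add: mult_ac)
      qed
    qed auto
    show "summable (\<lambda>l. \<nu> l powr \<epsilon> * (\<mu> l powr a) powr q)"
      using summable summable_Suc_iff[of "\<lambda>l. \<nu> l powr \<epsilon> * (\<mu> l powr a) powr q"]
      by (simp add: powr_powr mult.commute)
  qed (use inv idem ab in auto)
qed

theorem theorem1:
  fixes A :: "nat \<Rightarrow> 'a::banach \<Rightarrow>\<^sub>L 'a"
    and P :: "nat \<Rightarrow> 'a \<Rightarrow>\<^sub>L 'a"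
    and f :: "nat \<Rightarrow> 'a \<Rightarrow> 'a"
    and \<mu> \<nu> \<beta> \<beta>' :: "nat \<Rightarrow> real"
    and a b \<epsilon> D c q K C :: real
  assumes "c > 0" and "q > 1"
    and "\<And>m. m \<ge> 1 \<Longrightarrow> f m 0 = 0"
    and "\<And>m u v. m \<ge> 1 \<Longrightarrow>
           norm (f m u - f m v) \<le> c * norm (u - v) * (norm u + norm v) powr q"
    and "\<And>m. m \<ge> 1 \<Longrightarrow> blinfun_invertible (A m)"
    and "growth_rate \<mu>" and "growth_rate \<nu>"
    and "nonuniform_dichotomy A \<mu> \<nu> P a b \<epsilon> D"
    and "(\<lambda>m. \<mu> m powr a * \<mu> (m - 1) powr (- b) * \<nu> (m - 1) powr \<epsilon>) \<longlonglongrightarrow> 0"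
    and "summable (\<lambda>k. \<mu> (Suc k) powr (a * q) * \<nu> (Suc k) powr \<epsilon>)"
    and "\<beta> = radius \<mu> \<nu> a \<epsilon> q"
    and "\<beta>' = inner_radius \<mu> \<nu> a \<epsilon> q"
    and "K \<ge> 1"
    and "\<And>n m. 1 \<le> n \<Longrightarrow> n \<le> m \<Longrightarrow>
           (\<mu> m powr a * inverse (\<beta> m)) / (\<mu> (n - 1) powr a * inverse (\<beta> n)) \<le> K"
    and "C > D"
  shows "\<exists>\<delta>\<^sub>0>0. \<forall>\<delta>. 0 < \<delta> \<and> \<delta> < \<delta>\<^sub>0 \<longrightarrow>
    (\<exists>\<phi>\<in>graph_space P \<delta> \<beta>.
       locally_invariant A f P (\<delta> / (C * K)) \<beta>' \<delta> \<beta> \<phi> \<and>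
       (\<forall>\<psi>\<in>graph_space P \<delta> \<beta>. locally_invariant A f P (\<delta> / (C * K)) \<beta>' \<delta> \<beta> \<psi> \<longrightarrow>
          (\<forall>n\<ge>1. \<forall>\<xi>\<in>stable_ball P n (\<delta> / (C * K) * \<beta>' n). \<psi> n \<xi> = \<phi> n \<xi>)) \<and>
       (\<forall>n\<ge>1. \<forall>m\<ge>n.
          \<forall>\<xi>\<in>stable_ball P n (\<delta> / (C * K) * \<beta>' n). \<forall>\<xi>'\<in>stable_ball P n (\<delta> / (C * K) * \<beta>' n).
            norm (nonlinear_evol A f m n (\<xi> + \<phi> n \<xi>) - nonlinear_evol A f m n (\<xi>' + \<phi> n \<xi>'))
              \<le> 2 * C * (\<mu> m / \<mu> (n - 1)) powr a * \<nu> (n - 1) powr \<epsilon> * norm (\<xi> - \<xi>')))"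
proof -
  define p where "p k = \<mu> k powr a" for k
  define e where "e k = \<nu> k powr \<epsilon>" for k
  interpret perturbed_dichotomy A P p e D q f c C
    unfolding p_def e_def
  proof (intro perturbed_dichotomy.intro perturbed_dichotomy_axioms.intro)
    show "weighted_dichotomy A P (\<lambda>k. \<mu> k powr a) (\<lambda>k. \<nu> k powr \<epsilon>) D q"
      by (rule dichotomy_imp_weighted_dichotomy) (use assms in auto)
  qed (use assms in auto)
  have tail: "tail_sum \<mu> \<nu> a \<epsilon> q = S"
    by (rule ext) (simp add: tail_sum_def S_def p_def e_def powr_powr mult.commute)
  have \<beta>_eq: "\<beta> n = p (n - 1) / (e (n - 1) powr (1 + 1 / q) * S n powr (1 / q))" for n
    unfolding \<open>\<beta> = _\<close> radius_def tail by (simp add: p_def e_def powr_powr)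
  have \<beta>_pos: "0 < \<beta> n" for n
    unfolding \<beta>_eq using p_pos[of "n-1"] e_pos[of "n-1"] S_pos[of n] by simp
  have \<beta>': "\<beta>' = (\<lambda>n. \<beta> n / e (n - 1))"
    unfolding \<open>\<beta>' = _\<close> \<open>\<beta> = _\<close> inner_radius_def by (simp add: e_def powr_minus divide_inverse)
  \<comment> \<open>Both smallness conditions on \<open>\<delta>\<close> say that \<open>\<theta> * \<delta> powr q\<close> is at most a positive constant.\<close>
  define \<theta> where "\<theta> = c * D * (4 * C) powr q"
  define \<rho> where "\<rho> = min ((C - D) / (2 * C)) (1 / C)"
  have \<theta>: "0 < \<theta>" using c_pos D_ge C_pos by (simp add: \<theta>_def)
  have \<rho>: "0 < \<rho>" using C_gt C_pos by (simp add: \<rho>_def)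
  define \<delta>\<^sub>0 where "\<delta>\<^sub>0 = (\<rho> / \<theta>) powr (1 / q)"
  have "0 < \<delta>\<^sub>0" using \<theta> \<rho> by (simp add: \<delta>\<^sub>0_def)
  moreover have "\<exists>\<phi>\<in>graph_space P \<delta> \<beta>.
       locally_invariant A f P (\<delta> / (C * K)) \<beta>' \<delta> \<beta> \<phi> \<and>
       (\<forall>\<psi>\<in>graph_space P \<delta> \<beta>. locally_invariant A f P (\<delta> / (C * K)) \<beta>' \<delta> \<beta> \<psi> \<longrightarrow>
          (\<forall>n\<ge>1. \<forall>\<xi>\<in>stable_ball P n (\<delta> / (C * K) * \<beta>' n). \<psi> n \<xi> = \<phi> n \<xi>)) \<and>
       (\<forall>n\<ge>1. \<forall>m\<ge>n.
          \<forall>\<xi>\<in>stable_ball P n (\<delta> / (C * K) * \<beta>' n). \<forall>\<xi>'\<in>stable_ball P n (\<delta> / (C * K) * \<beta>' n).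
            norm (F m n (\<xi> + \<phi> n \<xi>) - F m n (\<xi>' + \<phi> n \<xi>'))
              \<le> 2 * C * (\<mu> m / \<mu> (n - 1)) powr a * \<nu> (n - 1) powr \<epsilon> * norm (\<xi> - \<xi>'))"
    if \<delta>: "0 < \<delta>" "\<delta> < \<delta>\<^sub>0" for \<delta>
  proof -
    have "c * D * (4 * C * \<delta>) powr q = \<theta> * \<delta> powr q"
      using C_pos \<delta> by (simp add: \<theta>_def powr_mult)
    also have "\<dots> \<le> \<theta> * \<delta>\<^sub>0 powr q"
      using \<theta> \<delta> q_pos by (intro mult_left_mono powr_mono2) auto
    also have "\<dots> = \<rho>"
      using \<theta> \<rho> q_pos by (simp add: \<delta>\<^sub>0_def powr_powr)
    finally have "c * D * (4 * C * \<delta>) powr q \<le> (C - D) / (2 * C)" "c * D * (4 * C * \<delta>) powr q \<le> 1 / C"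
      by (auto simp: \<rho>_def)
    then have \<delta>_small: "D + 2 * (c * D * (4 * C * \<delta>) powr q) * C \<le> C" "c * D * (4 * C * \<delta>) powr q * C \<le> 1"
      using C_pos by (simp_all add: pos_le_divide_eq mult_ac)
    interpret invariant_graph A P p e D q f c C \<beta> K \<delta>
    proof
      show "p m / \<beta> m \<le> K * (p (n - 1) / \<beta> n)" if "1 \<le> n" "n \<le> m" for n m
      proof -
        have "(p m / \<beta> m) / (p (n - 1) / \<beta> n) \<le> K"
          using assms(14)[OF that] by (simp add: p_def divide_inverse)
        then show ?thesis
          using p_pos[of "n-1"] \<beta>_pos[of n] by (simp only: pos_divide_le_eq divide_pos_pos)
      qed
    qed (use \<beta>_eq \<open>K \<ge> 1\<close> \<delta> \<delta>_small in auto)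
    have "norm (F m n (\<xi> + \<phi> n \<xi>) - F m n (\<xi>' + \<phi> n \<xi>'))
        \<le> 2 * C * (\<mu> m / \<mu> (n - 1)) powr a * \<nu> (n - 1) powr \<epsilon> * norm (\<xi> - \<xi>')"
      if n: "1 \<le> n" "n \<le> m" and \<xi>: "\<xi> \<in> inner_ball n" "\<xi>' \<in> inner_ball n" for n m \<xi> \<xi>'
    proof -
      have "norm (F m n (\<xi> + \<phi> n \<xi>) - F m n (\<xi>' + \<phi> n \<xi>'))
          \<le> 1 * (C * (e (n - 1) / p (n - 1) * norm (\<xi> - \<xi>')) * p m)"
        using orbit_lipschitz[OF n] inner_ball_subset[OF n(1)] \<xi> by auto
      also have "\<dots> \<le> 2 * (C * (e (n - 1) / p (n - 1) * norm (\<xi> - \<xi>')) * p m)"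
        using C_pos e_pos[of "n-1"] p_pos[of "n-1"] p_pos[of m] by (intro mult_right_mono) auto
      also have "\<dots> = 2 * C * (p m / p (n - 1)) * e (n - 1) * norm (\<xi> - \<xi>')"
        by simp
      also have "p m / p (n - 1) = (\<mu> m / \<mu> (n - 1)) powr a"
        unfolding p_def using growth_rate_ge_1[OF \<open>growth_rate \<mu>\<close>, of m] growth_rate_ge_1[OF \<open>growth_rate \<mu>\<close>, of "n-1"] by (simp add: powr_divide)
      also have "e (n - 1) = \<nu> (n - 1) powr \<epsilon>"
        by (simp only: e_def)
      finally show ?thesis .
    qed
    then show ?thesis
      unfolding \<beta>' using \<phi>_graph_space \<phi>_invariant \<phi>_unique by (intro bexI[of _ \<phi>]) blast+
  qed
  ultimately show ?thesis by blast
qed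

end
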